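(* Let $\Omega\subseteq\mathbb{R}^n$ be an open, connected, convex set with smooth boundary (the case $\Omega=\mathbb{R}^n$ being allowed) satisfying the interior cone condition, let $T>0$, $Q_T=\Omega\times(0,T)$ and $\Sigma_T=\partial\Omega\times(0,T)$. Let $u$ be a solution to $$\begin{cases}\partial_t u-\Delta u=0&\text{in }Q_T,\\ \partial_\nu u=0&\text{on }\Sigma_T,\end{cases}$$ such that $u\in L^\infty(Q_T)$ with $0<u\le A$ for a constant $A$, and assume $Du\in L^\infty(Q_T)$ and $u\in L^2(0,T;W^{4,2}(\Omega))$. Then, for any $\tau\in(0,T)$, pointwise in $\Omega$, $$\Delta\log u(\tau)+2|D\log u(\tau)|^2=\frac{\Delta u(\tau)}{u(\tau)}+\frac{|Du(\tau)|^2}{u^2(\tau)}\ \le\ \frac1\tau\left(n+\frac72\log\left(\frac{A}{u(\tau)}\right)\right).$$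
   Context: $D$ and $\Delta$ are the gradient and Laplacian in the $x$-variable; $\nu$ is the outward normal to $\partial\Omega$; $u(\tau)=u(\cdot,\tau)$. When $\Omega=\mathbb{R}^n$ no boundary condition appears. Solutions $u$ of the heat equation are smooth in $Q_T$ and up to the boundary points on $\Sigma_T$, and extend continuously up to $t=0$. Interior cone condition: there exists a finite cone such that every point of $\Omega$ is the vertex of a cone congruent to the given one and contained in $\Omega$. *)

theory Defs
  imports "HOL-Analysis.Analysis"
begin

section \<open>Classical derivatives\<close>

definition grad :: "('a::euclidean_space \<Rightarrow> real) \<Rightarrow> 'a \<Rightarrow> 'a" where
  "grad f x = (\<Sum>b\<in>Basis. frechet_derivative f (at x) b *\<^sub>R b)"

definition laplacian :: "('a::euclidean_space \<Rightarrow> real) \<Rightarrow> 'a \<Rightarrow> real" where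
  "laplacian f x =
     (\<Sum>b\<in>Basis. frechet_derivative (\<lambda>y. frechet_derivative f (at y) b) (at x) b)"

text \<open>
  \<open>Ck_on k S f\<close> is used for open \<open>S\<close> and for \<open>S = closure \<Omega> \<times> {0<..<T}\<close> with \<open>\<Omega>\<close> open, convex and
  nonempty. In both cases derivatives within \<open>S\<close> are unique, so the choice made by
  \<^const>\<open>frechet_derivative\<close> is immaterial; they are the usual derivatives in the interior. In the
  second case the condition says that \<open>f\<close> is \<open>C\<^sup>k\<close> in the interior with all derivatives up to
  order \<open>k\<close> extending continuously to \<open>S\<close>, i.e. that \<open>f\<close> is \<open>C\<^sup>k\<close> up to the lateral boundary.
\<close>

primrec Ck_on :: "nat \<Rightarrow> 'a::euclidean_space set \<Rightarrow> ('a \<Rightarrow> real) \<Rightarrow> bool" where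
  "Ck_on 0 S f \<longleftrightarrow> continuous_on S f"
| "Ck_on (Suc k) S f \<longleftrightarrow> f differentiable_on S \<and>
     (\<forall>b\<in>Basis. Ck_on k S (\<lambda>x. frechet_derivative f (at x within S) b))"

definition smooth_on :: "'a::euclidean_space set \<Rightarrow> ('a \<Rightarrow> real) \<Rightarrow> bool" where
  "smooth_on S f \<longleftrightarrow> (\<forall>k. Ck_on k S f)"

section \<open>Domains\<close>

text \<open>
  Near \<open>x\<close>, the set \<open>\<Omega>\<close> is the region above the graph, in the unit direction \<open>e\<close>, of a smooth
  function on the hyperplane orthogonal to \<open>e\<close>. To avoid a separate type of dimension \<open>n - 1\<close>,
  that function is given as \<open>\<gamma>\<close> on the whole space, evaluated only at projections onto the
  hyperplane.
\<close>

definition graph_fun :: "'a::euclidean_space \<Rightarrow> ('a \<Rightarrow> real) \<Rightarrow> 'a \<Rightarrow> real" where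
  "graph_fun e \<gamma> y = \<gamma> (y - (y \<bullet> e) *\<^sub>R e) - y \<bullet> e"

definition boundary_graph ::
    "'a::euclidean_space set \<Rightarrow> 'a \<Rightarrow> real \<Rightarrow> 'a \<Rightarrow> ('a \<Rightarrow> real) \<Rightarrow> bool" where
  "boundary_graph \<Omega> x r e \<gamma> \<longleftrightarrow>
     r > 0 \<and> norm e = 1 \<and> smooth_on UNIV \<gamma> \<and>
     \<Omega> \<inter> ball x r = {y \<in> ball x r. graph_fun e \<gamma> y < 0}"

definition smooth_boundary :: "'a::euclidean_space set \<Rightarrow> bool" where
  "smooth_boundary \<Omega> \<longleftrightarrow> (\<forall>x\<in>frontier \<Omega>. \<exists>r e \<gamma>. boundary_graph \<Omega> x r e \<gamma>)"

text \<open>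
  The gradient of \<^const>\<open>graph_fun\<close> has component \<open>-1\<close> along \<open>e\<close>, hence does not vanish, and
  its normalisation \<^const>\<open>sgn\<close> does not depend on the graph representation.
\<close>

definition outward_unit_normal :: "'a::euclidean_space set \<Rightarrow> 'a \<Rightarrow> 'a \<Rightarrow> bool" where
  "outward_unit_normal \<Omega> x \<nu> \<longleftrightarrow>
     (\<exists>r e \<gamma>. boundary_graph \<Omega> x r e \<gamma> \<and> \<nu> = sgn (grad (graph_fun e \<gamma>) x))"

text \<open>
  Vertex \<open>x\<close>, axis direction \<open>v\<close> (a unit vector), height \<open>h\<close> and half-angle \<open>\<theta>\<close>. Two such
  cones are congruent iff they have the same height and half-angle.
\<close>

definition finite_cone :: "'a::euclidean_space \<Rightarrow> 'a \<Rightarrow> real \<Rightarrow> real \<Rightarrow> 'a set" where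
  "finite_cone x v h \<theta> =
     {y. norm (y - x) \<le> h \<and> norm (y - x) * cos \<theta> \<le> (y - x) \<bullet> v}"

definition interior_cone_condition :: "'a::euclidean_space set \<Rightarrow> bool" where
  "interior_cone_condition \<Omega> \<longleftrightarrow>
     (\<exists>h \<theta>. 0 < h \<and> 0 < \<theta> \<and> \<theta> \<le> pi / 2 \<and>
        (\<forall>x\<in>\<Omega>. \<exists>v. norm v = 1 \<and> finite_cone x v h \<theta> \<subseteq> \<Omega>))"

section \<open>Function spaces\<close>

text \<open>Elements of Lebesgue and Sobolev spaces are represented by functions, not by classes
  modulo null sets.\<close>

definition L_infinity :: "'a::euclidean_space set \<Rightarrow> ('a \<Rightarrow> 'b::euclidean_space) \<Rightarrow> bool" where
  "L_infinity S f \<longleftrightarrow> f \<in> borel_measurable (lebesgue_on S) \<and>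
     (\<exists>K. AE z in lebesgue_on S. norm (f z) \<le> K)"

definition L_two :: "'a::euclidean_space set \<Rightarrow> ('a \<Rightarrow> real) \<Rightarrow> bool" where
  "L_two S f \<longleftrightarrow> f \<in> borel_measurable (lebesgue_on S) \<and>
     integrable (lebesgue_on S) (\<lambda>x. (f x)\<^sup>2)"

definition test_function :: "'a::euclidean_space set \<Rightarrow> ('a \<Rightarrow> real) \<Rightarrow> bool" where
  "test_function \<Omega> \<phi> \<longleftrightarrow> smooth_on UNIV \<phi> \<and>
     (\<exists>K. compact K \<and> K \<subseteq> \<Omega> \<and> (\<forall>x. x \<notin> K \<longrightarrow> \<phi> x = 0))"

text \<open>A partial derivative of order \<open>k\<close> is indexed by the list, of length \<open>k\<close>, of the basis
  vectors along which one differentiates.\<close>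

definition deriv_indices :: "nat \<Rightarrow> 'a::euclidean_space list set" where
  "deriv_indices k = {bs. set bs \<subseteq> Basis \<and> length bs \<le> k}"

primrec iter_deriv :: "'a::euclidean_space list \<Rightarrow> ('a \<Rightarrow> real) \<Rightarrow> 'a \<Rightarrow> real" where
  "iter_deriv [] f = f"
| "iter_deriv (b # bs) f = (\<lambda>x. frechet_derivative (iter_deriv bs f) (at x) b)"

definition locally_integrable :: "'a::euclidean_space set \<Rightarrow> ('a \<Rightarrow> real) \<Rightarrow> bool" where
  "locally_integrable \<Omega> f \<longleftrightarrow> (\<forall>K. compact K \<and> K \<subseteq> \<Omega> \<longrightarrow> integrable (lebesgue_on K) f)"

definition is_weak_deriv ::
    "'a::euclidean_space set \<Rightarrow> 'a list \<Rightarrow> ('a \<Rightarrow> real) \<Rightarrow> ('a \<Rightarrow> real) \<Rightarrow> bool" where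
  "is_weak_deriv \<Omega> bs f g \<longleftrightarrow> locally_integrable \<Omega> f \<and> locally_integrable \<Omega> g \<and>
     (\<forall>\<phi>. test_function \<Omega> \<phi> \<longrightarrow>
        (LINT x|lebesgue_on \<Omega>. f x * iter_deriv bs \<phi> x) =
        (-1) ^ length bs * (LINT x|lebesgue_on \<Omega>. g x * \<phi> x))"

text \<open>Weak derivatives are unique up to null sets of \<open>\<Omega>\<close>.\<close>

definition weak_deriv ::
    "'a::euclidean_space set \<Rightarrow> 'a list \<Rightarrow> ('a \<Rightarrow> real) \<Rightarrow> 'a \<Rightarrow> real" where
  "weak_deriv \<Omega> bs f = (SOME g. is_weak_deriv \<Omega> bs f g)"

definition sobolev_W2 :: "nat \<Rightarrow> 'a::euclidean_space set \<Rightarrow> ('a \<Rightarrow> real) set" where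
  "sobolev_W2 k \<Omega> = {f. \<forall>bs\<in>deriv_indices k. \<exists>g. is_weak_deriv \<Omega> bs f g \<and> L_two \<Omega> g}"

definition sobolev_norm :: "nat \<Rightarrow> 'a::euclidean_space set \<Rightarrow> ('a \<Rightarrow> real) \<Rightarrow> real" where
  "sobolev_norm k \<Omega> f =
     sqrt (\<Sum>bs\<in>deriv_indices k. LINT x|lebesgue_on \<Omega>. (weak_deriv \<Omega> bs f x)\<^sup>2)"

text \<open>
  \<open>L2_time_W2 T k \<Omega> w\<close> says that \<open>w\<close> belongs to the Bochner space \<open>L\<^sup>2(0,T; W\<^sup>k\<^sup>,\<^sup>2(\<Omega>))\<close>: it is
  almost everywhere the limit in \<open>W\<^sup>k\<^sup>,\<^sup>2(\<Omega>)\<close> of simple functions, and the square of its norm is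
  integrable.
\<close>

definition simple_W2 ::
    "real \<Rightarrow> nat \<Rightarrow> 'a::euclidean_space set \<Rightarrow> (real \<Rightarrow> 'a \<Rightarrow> real) \<Rightarrow> bool" where
  "simple_W2 T k \<Omega> s \<longleftrightarrow> finite (s ` {0<..<T}) \<and> s ` {0<..<T} \<subseteq> sobolev_W2 k \<Omega> \<and>
     (\<forall>f. {t\<in>{0<..<T}. s t = f} \<in> sets lebesgue)"

definition L2_time_W2 ::
    "real \<Rightarrow> nat \<Rightarrow> 'a::euclidean_space set \<Rightarrow> (real \<Rightarrow> 'a \<Rightarrow> real) \<Rightarrow> bool" where
  "L2_time_W2 T k \<Omega> w \<longleftrightarrow>
     (AE t in lebesgue_on {0<..<T}. w t \<in> sobolev_W2 k \<Omega>) \<and>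
     (\<exists>s. (\<forall>j. simple_W2 T k \<Omega> (s j)) \<and>
        (AE t in lebesgue_on {0<..<T}.
           (\<lambda>j. sobolev_norm k \<Omega> (\<lambda>x. s j t x - w t x)) \<longlonglongrightarrow> 0)) \<and>
     integrable (lebesgue_on {0<..<T}) (\<lambda>t. (sobolev_norm k \<Omega> (w t))\<^sup>2)"

section \<open>The Neumann problem for the heat equation\<close>

text \<open>
  \<open>u x t\<close> is taken on \<open>closure \<Omega> \<times> {0..<T}\<close>: its values on the lateral boundary and at \<open>t = 0\<close> are
  those of the continuous extension. The normal derivative is computed from inside \<open>closure \<Omega>\<close>.
\<close>

definition neumann_heat_solution ::
    "'a::euclidean_space set \<Rightarrow> real \<Rightarrow> ('a \<Rightarrow> real \<Rightarrow> real) \<Rightarrow> bool" where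
  "neumann_heat_solution \<Omega> T u \<longleftrightarrow>
     smooth_on (closure \<Omega> \<times> {0<..<T}) (\<lambda>(x, t). u x t) \<and>
     continuous_on (closure \<Omega> \<times> {0..<T}) (\<lambda>(x, t). u x t) \<and>
     (\<forall>x\<in>\<Omega>. \<forall>t\<in>{0<..<T}. deriv (\<lambda>s. u x s) t - laplacian (\<lambda>y. u y t) x = 0) \<and>
     (\<forall>x\<in>frontier \<Omega>. \<forall>t\<in>{0<..<T}. \<forall>\<nu>. outward_unit_normal \<Omega> x \<nu> \<longrightarrow>
        frechet_derivative (\<lambda>y. u y t) (at x within closure \<Omega>) \<nu> = 0)"

end

theory Submission
  imports Defs
begin

text \<open>
  For \<open>s > 0\<close> and \<open>\<epsilon> > 0\<close> the function
  \<open>W = (t - s) (\<partial>\<^sub>t u + \<bar>D u\<bar>\<^sup>2 / (u + \<epsilon>)) - (u + \<epsilon>) (n + 7/2 log ((A + \<epsilon>) / (u + \<epsilon>)))\<close>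
  is smooth up to the lateral boundary and nonpositive at \<open>t = s\<close>. Where it is positive it
  satisfies \<open>\<partial>\<^sub>t W - \<Delta> W \<le> - \<kappa> W\<^sup>2\<close>, and on \<open>\<partial>\<Omega>\<close> its outward normal derivative is nonpositive
  because of the Neumann condition and the convexity of \<open>\<Omega>\<close>. The quadratic absorption term makes
  \<open>L R\<^sup>2 / (R\<^sup>2 - \<bar>x - x\<^sub>0\<bar>\<^sup>2)\<^sup>2\<close> a supersolution, and for \<open>x\<^sub>0\<close> in the convex set \<open>\<Omega>\<close> its outward
  normal derivative is positive. Hence \<open>W (x\<^sub>0, \<tau>) \<le> L / R\<^sup>2\<close> by the pointwise maximum principle on
  a compact set, without any growth condition at infinity; now let \<open>R \<rightarrow> \<infinity>\<close>, \<open>s \<rightarrow> 0\<close>, \<open>\<epsilon> \<rightarrow> 0\<close>.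
\<close>

section \<open>Derivatives on convex sets with nonempty interior\<close>

text \<open>Multiplying the claim by \<open>\<tau> * u\<close> and replacing the Laplacian of u by
  its time derivative turns it into W \<le> 0 with s = \<epsilon> = 0; this is the origin of W. The
  logarithm is there because the heat operator sends -(u + \<epsilon>) log (u + \<epsilon>) to |D
  u|^2 / (u + \<epsilon>), a counterweight to the terms that differentiating the factor t - s
  creates. The obstacle is that \<Omega> may be unbounded: a maximum of W need not be attained, and
  among the quantities in W only u and D u come with pointwise bounds, not the time derivative. The
  two parameters repair the edges of the domain. At time 0 only continuity of u is given, so the
  argument starts at s > 0. On the lateral boundary u is known only to be nonnegative, so \<epsilon>
  keeps denominators and logarithms meaningful; it also turns the gradient bound into a bound for |D
  u|^2 / (u + \<epsilon>), on which the decay rate \<kappa> depends.\<close>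

definition pd :: "'a::euclidean_space set \<Rightarrow> 'a \<Rightarrow> ('a \<Rightarrow> real) \<Rightarrow> 'a \<Rightarrow> real" where
  "pd S v f z = frechet_derivative f (at z within S) v"

lemma has_derivative_along_line:
  fixes f :: "'a::real_normed_vector \<Rightarrow> real"
  assumes "(f has_derivative f') (at z within S)" "\<And>r. r \<in> I \<Longrightarrow> z + r *\<^sub>R v \<in> S"
  shows "((\<lambda>r. f (z + r *\<^sub>R v)) has_real_derivative f' v) (at 0 within I)"
proof -
  interpret bounded_linear f' using assms(1) by (rule has_derivative_bounded_linear)
  have "((\<lambda>r. z + r *\<^sub>R v) has_derivative (\<lambda>r. r *\<^sub>R v)) (at 0 within I)"
    by (auto intro!: derivative_eq_intros)
  moreover have "(f has_derivative f') (at (z + 0 *\<^sub>R v) within (\<lambda>r. z + r *\<^sub>R v) ` I)"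
    using assms by (auto intro: has_derivative_subset)
  ultimately have "((\<lambda>r. f (z + r *\<^sub>R v)) has_derivative (\<lambda>r. f' (r *\<^sub>R v))) (at 0 within I)"
    using has_derivative_compose has_derivative_in_compose by blast
  then show ?thesis
    by (simp add: has_field_derivative_def scaleR mult_commute_abs)
qed

lemma has_derivative_along_line_at:
  fixes F :: "'a::real_normed_vector \<Rightarrow> real"
  assumes "(F has_derivative F') (at (y + s *\<^sub>R v))"
  shows "((\<lambda>r. F (y + r *\<^sub>R v)) has_real_derivative F' v) (at s)"
proof -
  from has_derivative_along_line[OF assms, of UNIV v]
  have "((\<lambda>r. F (y + (r + s) *\<^sub>R v)) has_real_derivative F' v) (at 0)"
    by (simp add: algebra_simps)
  then show ?thesis using DERIV_shift[of "\<lambda>r. F (y + r *\<^sub>R v)" "F' v" 0 s] by simp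
qed

text \<open>On \<open>y - z\<close> with \<open>y\<close> in \<open>S\<close>, the value is fixed by
  the one-sided derivative along the segment from \<open>z\<close> to \<open>y\<close>. Differences
  of points of a ball inside \<open>S\<close> are multiples of every direction, and linearity does
  the rest.\<close>

lemma convex_has_derivative_unique:
  fixes f :: "'a::euclidean_space \<Rightarrow> real"
  assumes S: "convex S" "interior S \<noteq> {}" and z: "z \<in> S"
    and 1: "(f has_derivative f1) (at z within S)" and 2: "(f has_derivative f2) (at z within S)"
  shows "f1 = f2"
proof -
  interpret f1: bounded_linear f1 using 1 by (rule has_derivative_bounded_linear)
  interpret f2: bounded_linear f2 using 2 by (rule has_derivative_bounded_linear)
  have eq: "f1 (y - z) = f2 (y - z)" if "y \<in> S" for y
  proof -
    have "z + r *\<^sub>R (y - z) \<in> S" if "r \<in> {0..1}" for r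
    proof -
      have "z + r *\<^sub>R (y - z) = (1 - r) *\<^sub>R z + r *\<^sub>R y" by (simp add: algebra_simps)
      then show ?thesis using that S(1) z \<open>y \<in> S\<close> by (simp add: convexD)
    qed
    have D: "((\<lambda>r. f (z + r *\<^sub>R (y - z))) has_real_derivative f1 (y - z)) (at 0 within {0..1})"
      "((\<lambda>r. f (z + r *\<^sub>R (y - z))) has_real_derivative f2 (y - z)) (at 0 within {0..1})"
      by (rule has_derivative_along_line[OF 1] has_derivative_along_line[OF 2], fact)+
    show ?thesis
      using vector_derivative_unique_within_closed_interval[of 0 1 0]
        D[unfolded has_real_derivative_iff_has_vector_derivative] by auto
  qed
  obtain c where c: "c \<in> interior S" using S by blast
  then obtain e where e: "e > 0" "ball c e \<subseteq> S" using mem_interior by blast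
  show ?thesis
  proof
    fix v :: 'a
    obtain r where r: "r > 0" "norm (r *\<^sub>R v) < e"
    proof
      show "e / (norm v + 1) > 0" using e(1) by (intro divide_pos_pos) (auto intro: add_nonneg_pos)
      have "e * norm v < e * (norm v + 1)" using e(1) by simp
      then show "norm ((e / (norm v + 1)) *\<^sub>R v) < e"
        using e(1) by (auto simp: field_simps add_pos_nonneg)
    qed
    have "c \<in> S" "c + r *\<^sub>R v \<in> S" using e r by (auto simp: dist_norm subset_iff)
    from eq[OF this(1)] eq[OF this(2)] have "f1 (r *\<^sub>R v) = f2 (r *\<^sub>R v)"
      by (simp add: f1.add f2.add f1.diff f2.diff)
    then show "f1 v = f2 v" using r by (simp add: f1.scaleR f2.scaleR)
  qed
qed

text \<open>The double difference \<open>f (z + ha + hb) - f (z + ha) - f (z + hb) + f z\<close> does not see the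
  order of differentiation.\<close>

lemma double_difference_mean_value:
  fixes f :: "'a::real_normed_vector \<Rightarrow> real"
  assumes r: "ball z r \<subseteq> Q" and h: "h > 0" "h * (norm a + norm b) < r"
    and f: "\<And>y. y \<in> Q \<Longrightarrow> (f has_derivative f' y) (at y)"
    and g: "\<And>y. y \<in> Q \<Longrightarrow> ((\<lambda>y. f' y a) has_derivative g' y) (at y)"
  shows "\<exists>s t. 0 \<le> s \<and> s \<le> h \<and> 0 \<le> t \<and> t \<le> h \<and>
     f (z + h *\<^sub>R a + h *\<^sub>R b) - f (z + h *\<^sub>R a) - f (z + h *\<^sub>R b) + f z
       = h\<^sup>2 * g' (z + s *\<^sub>R a + t *\<^sub>R b) b"
proof -
  have inQ: "z + s *\<^sub>R a + t *\<^sub>R b \<in> Q" if "0 \<le> s" "s \<le> h" "0 \<le> t" "t \<le> h" for s t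
  proof -
    have "norm (s *\<^sub>R a + t *\<^sub>R b) \<le> h * norm a + h * norm b"
      by (rule norm_triangle_mono) (use that in \<open>auto intro: mult_right_mono\<close>)
    also have "\<dots> < r" using h by (simp add: algebra_simps)
    moreover have "dist z (z + s *\<^sub>R a + t *\<^sub>R b) = norm (s *\<^sub>R a + t *\<^sub>R b)"
      by (metis add.assoc add_diff_cancel_left' dist_commute dist_norm)
    ultimately show ?thesis using r by (auto simp: subset_iff)
  qed
  \<comment> \<open>The increment of \<open>\<phi>\<close> over [0, h] is the double difference; the
    mean value theorem is applied first in direction \<open>a\<close>, then in direction
    \<open>b\<close>.\<close>
  define \<phi> where "\<phi> s = f (z + h *\<^sub>R b + s *\<^sub>R a) - f (z + s *\<^sub>R a)" for s
  have "\<exists>s. 0 < s \<and> s < h \<and> \<phi> h - \<phi> 0 = (h - 0) * (f' (z + h *\<^sub>R b + s *\<^sub>R a) a - f' (z + s *\<^sub>R a) a)"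
  proof (rule MVT2[OF h(1)])
    fix s assume s: "0 \<le> s" "s \<le> h"
    show "(\<phi> has_real_derivative (f' (z + h *\<^sub>R b + s *\<^sub>R a) a - f' (z + s *\<^sub>R a) a)) (at s)"
      unfolding \<phi>_def using inQ[OF s, of h] inQ[OF s, of 0] h
      by (intro DERIV_diff has_derivative_along_line_at f) (auto simp: algebra_simps)
  qed
  then obtain s where s: "0 < s" "s < h"
    and es: "\<phi> h - \<phi> 0 = h * (f' (z + h *\<^sub>R b + s *\<^sub>R a) a - f' (z + s *\<^sub>R a) a)" by auto
  have "\<exists>t. 0 < t \<and> t < h \<and> f' (z + s *\<^sub>R a + h *\<^sub>R b) a - f' (z + s *\<^sub>R a + 0 *\<^sub>R b) a
      = (h - 0) * g' (z + s *\<^sub>R a + t *\<^sub>R b) b"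
  proof (rule MVT2[OF h(1)])
    fix t assume t: "0 \<le> t" "t \<le> h"
    show "((\<lambda>t. f' (z + s *\<^sub>R a + t *\<^sub>R b) a) has_real_derivative g' (z + s *\<^sub>R a + t *\<^sub>R b) b) (at t)"
      using inQ[of s t] s t by (intro has_derivative_along_line_at g) auto
  qed
  then obtain t where t: "0 < t" "t < h"
    and et: "f' (z + s *\<^sub>R a + h *\<^sub>R b) a - f' (z + s *\<^sub>R a) a = h * g' (z + s *\<^sub>R a + t *\<^sub>R b) b" by auto
  have "f' (z + h *\<^sub>R b + s *\<^sub>R a) a = f' (z + s *\<^sub>R a + h *\<^sub>R b) a" by (simp add: algebra_simps)
  then have "\<phi> h - \<phi> 0 = h\<^sup>2 * g' (z + s *\<^sub>R a + t *\<^sub>R b) b"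
    using es et by (simp add: power2_eq_square)
  moreover have "\<phi> h - \<phi> 0 = f (z + h *\<^sub>R a + h *\<^sub>R b) - f (z + h *\<^sub>R a) - f (z + h *\<^sub>R b) + f z"
    by (simp add: \<phi>_def algebra_simps)
  ultimately show ?thesis using s t by (intro exI[of _ s] exI[of _ t]) auto
qed

lemma mixed_derivatives_commute:
  fixes f :: "'a::real_normed_vector \<Rightarrow> real"
  assumes Q: "open Q" "z \<in> Q"
    and f: "\<And>y. y \<in> Q \<Longrightarrow> (f has_derivative f' y) (at y)"
    and g: "\<And>y. y \<in> Q \<Longrightarrow> ((\<lambda>y. f' y a) has_derivative g' y) (at y)"
    and k: "\<And>y. y \<in> Q \<Longrightarrow> ((\<lambda>y. f' y b) has_derivative k' y) (at y)"
    and cont: "isCont (\<lambda>y. g' y b) z" "isCont (\<lambda>y. k' y a) z"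
  shows "g' z b = k' z a"
proof (rule ccontr)
  \<comment> \<open>Half the supposed gap: one common value cannot lie within \<open>e\<close> of
    both sides.\<close>
  define e where "e = \<bar>g' z b - k' z a\<bar> / 2"
  assume "g' z b \<noteq> k' z a"
  then have e: "e > 0" by (simp add: e_def)
  obtain r where r: "r > 0" "ball z r \<subseteq> Q" using Q openE by blast
  obtain d1 where d1: "d1 > 0" "\<And>y. dist y z < d1 \<Longrightarrow> \<bar>g' y b - g' z b\<bar> < e"
    using cont(1) e by (auto simp: continuous_at_eps_delta dist_real_def)
  obtain d2 where d2: "d2 > 0" "\<And>y. dist y z < d2 \<Longrightarrow> \<bar>k' y a - k' z a\<bar> < e"
    using cont(2) e by (auto simp: continuous_at_eps_delta dist_real_def)
  define d where "d = min r (min d1 d2)"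
  \<comment> \<open>Makes \<open>h * (norm a + norm b)\<close> at most \<open>d / 2\<close>, so the
    whole parallelogram stays within \<open>d\<close> of \<open>z\<close>; the \<open>+ 1\<close>
    keeps the denominator positive when \<open>a\<close> and \<open>b\<close> vanish.\<close>
  define h where "h = d / (2 * (norm a + norm b + 1))"
  have n: "norm a + norm b + 1 > 0" by (simp add: add_nonneg_pos)
  have d: "d > 0" using r d1 d2 by (simp add: d_def)
  have h: "h > 0" using d n by (simp add: h_def)
  have hd: "h * (norm a + norm b) < d"
  proof -
    have "h * (norm a + norm b) \<le> h * (norm a + norm b + 1)" using h by simp
    also have "\<dots> = d / 2" 
    proof -
      have "d / (2 * m) * m = d / 2" if "m > 0" for m :: real using that by simp
      from this[OF n] show ?thesis by (simp only: h_def)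
    qed
    finally show ?thesis using d by simp
  qed
  have near: "dist (z + s *\<^sub>R p + t *\<^sub>R q) z < d"
    if "0 \<le> s" "s \<le> h" "0 \<le> t" "t \<le> h" "norm p + norm q = norm a + norm b" for s t p q
  proof -
    have "norm (s *\<^sub>R p + t *\<^sub>R q) \<le> h * norm p + h * norm q"
      by (rule norm_triangle_mono) (use that in \<open>auto intro: mult_right_mono\<close>)
    then have "norm (s *\<^sub>R p + t *\<^sub>R q) < d" using hd that(5) by (metis distrib_left order_le_less_trans)
    then show ?thesis by (simp add: dist_norm add.assoc)
  qed
  have hr: "h * (norm a + norm b) < r" "h * (norm b + norm a) < r"
    using hd by (auto simp: d_def add.commute)
  obtain s t where st: "0 \<le> s" "s \<le> h" "0 \<le> t" "t \<le> h"
    and e1: "f (z + h *\<^sub>R a + h *\<^sub>R b) - f (z + h *\<^sub>R a) - f (z + h *\<^sub>R b) + f z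
       = h\<^sup>2 * g' (z + s *\<^sub>R a + t *\<^sub>R b) b"
    using double_difference_mean_value[OF r(2) h hr(1) f g] by blast
  obtain s' t' where st': "0 \<le> s'" "s' \<le> h" "0 \<le> t'" "t' \<le> h"
    and e2: "f (z + h *\<^sub>R b + h *\<^sub>R a) - f (z + h *\<^sub>R b) - f (z + h *\<^sub>R a) + f z
       = h\<^sup>2 * k' (z + s' *\<^sub>R b + t' *\<^sub>R a) a"
    using double_difference_mean_value[OF r(2) h hr(2) f k] by blast
  have sw: "z + h *\<^sub>R a + h *\<^sub>R b = z + h *\<^sub>R b + h *\<^sub>R a" by (simp add: add_ac)
  have "h\<^sup>2 * g' (z + s *\<^sub>R a + t *\<^sub>R b) b = h\<^sup>2 * k' (z + s' *\<^sub>R b + t' *\<^sub>R a) a"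
    using e1[unfolded sw] e2 by linarith
  then have "g' (z + s *\<^sub>R a + t *\<^sub>R b) b = k' (z + s' *\<^sub>R b + t' *\<^sub>R a) a" using h by simp
  moreover have "\<bar>g' (z + s *\<^sub>R a + t *\<^sub>R b) b - g' z b\<bar> < e"
    using near[OF st] by (intro d1(2)) (simp add: d_def)
  moreover have "\<bar>k' (z + s' *\<^sub>R b + t' *\<^sub>R a) a - k' z a\<bar> < e"
    using near[OF st'] by (intro d2(2)) (simp add: d_def)
  ultimately show False by (simp add: e_def abs_if split: if_splits)
qed

text \<open>The setting in which \<open>pd\<close> behaves like an ordinary derivative at boundary
  points too, since derivatives within such a set are unique. \<open>S\<close> may be neither open
  nor closed, as the space-time cylinder with its lateral boundary is.\<close>

locale convex_body =
  fixes S :: "'a::euclidean_space set"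
  assumes convex_S: "convex S" and interior_S: "interior S \<noteq> {}"
begin

lemma smooth_on_imp:
  assumes "smooth_on S f"
  shows "continuous_on S f" "f differentiable_on S" "b \<in> Basis \<Longrightarrow> smooth_on S (pd S b f)"
proof -
  have C: "Ck_on k S f" for k using assms by (simp add: smooth_on_def)
  show "continuous_on S f" using C[of 0] by simp
  show "f differentiable_on S" using C[of 1] by simp
  show "smooth_on S (pd S b f)" if "b \<in> Basis"
    unfolding smooth_on_def using C[of "Suc _"] that by (simp add: pd_def[abs_def])
qed

lemma has_derivative_pd:
  assumes "f differentiable_on S" "z \<in> S"
  shows "(f has_derivative (\<lambda>v. pd S v f z)) (at z within S)"
  using assms by (simp add: differentiable_on_def frechet_derivative_works pd_def[abs_def])

lemma pd_eqI: "(f has_derivative f') (at z within S) \<Longrightarrow> z \<in> S \<Longrightarrow> pd S v f z = f' v"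
  by (metis (no_types, lifting) convex_S convex_has_derivative_unique differentiableI
      frechet_derivative_works interior_S pd_def)

lemma pd_linear: "f differentiable_on S \<Longrightarrow> z \<in> S \<Longrightarrow> linear (\<lambda>v. pd S v f z)"
  using has_derivative_pd has_derivative_linear by blast

text \<open>Being a derivative within \<open>S\<close> depends only on values on \<open>S\<close>,
  and \<open>frechet_derivative\<close> is a choice from that predicate. Hence identities known only
  on \<open>S\<close> may be differentiated.\<close>

lemma pd_cong:
  assumes "\<And>y. y \<in> S \<Longrightarrow> f y = g y" "z \<in> S"
  shows "pd S v f z = pd S v g z"
proof -
  have "(f has_derivative f') (at z within S) \<longleftrightarrow> (g has_derivative f') (at z within S)" for f'
    using assms by (metis has_derivative_transform)
  then show ?thesis by (simp add: pd_def frechet_derivative_def)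
qed

lemma has_derivative_pd_interior:
  assumes "f differentiable_on S" "z \<in> interior S"
  shows "(f has_derivative (\<lambda>v. pd S v f z)) (at z)"
  using has_derivative_pd[OF assms(1)] assms(2) interior_subset[of S] at_within_interior[of z S]
  by (metis subsetD)

text \<open>The interior of a convex set is dense in it as soon as it is nonempty. This is how the
  heat equation, the symmetry of second derivatives and the bounds on u reach the lateral
  boundary.\<close>

lemma eq_on_closure:
  assumes "continuous_on S f" "continuous_on S (g :: 'a \<Rightarrow> real)"
    and "\<And>y. y \<in> interior S \<Longrightarrow> f y = g y" "z \<in> S"
  shows "f z = g z"
proof -
  have "z \<in> closure (interior S)"
    using assms(4) convex_closure_interior[OF convex_S interior_S] closure_subset by blast
  then obtain x where x: "\<And>n. x n \<in> interior S" "x \<longlonglongrightarrow> z"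
    using closure_sequential by blast
  have xS: "\<And>n. x n \<in> S" using x(1) interior_subset by blast
  have "(\<lambda>n. f (x n)) \<longlonglongrightarrow> f z" "(\<lambda>n. g (x n)) \<longlonglongrightarrow> g z"
    using assms(1,2,4) x xS by (auto simp: continuous_on_sequentially o_def)
  then show ?thesis using x assms(3) by (simp add: LIMSEQ_unique)
qed

lemma pd_commute:
  assumes f: "smooth_on S f" and ab: "a \<in> Basis" "b \<in> Basis" and z: "z \<in> S"
  shows "pd S a (pd S b f) z = pd S b (pd S a f) z"
proof (rule eq_on_closure[OF _ _ _ z])
  note [simp] = smooth_on_imp
  show c: "continuous_on S (pd S a (pd S b f))" "continuous_on S (pd S b (pd S a f))"
    using f ab by auto
  show "pd S a (pd S b f) z = pd S b (pd S a f) z" if z: "z \<in> interior S" for z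
  proof (rule mixed_derivatives_commute[OF open_interior z, of f "\<lambda>y v. pd S v f y" b "\<lambda>y v. pd S v (pd S b f) y"
        a "\<lambda>y v. pd S v (pd S a f) y"])
    show "(f has_derivative (\<lambda>v. pd S v f y)) (at y)"
      and "((\<lambda>y. pd S b f y) has_derivative (\<lambda>v. pd S v (pd S b f) y)) (at y)"
      and "((\<lambda>y. pd S a f y) has_derivative (\<lambda>v. pd S v (pd S a f) y)) (at y)"
      if "y \<in> interior S" for y
      using that f ab by (auto intro!: has_derivative_pd_interior)
    show "isCont (pd S a (pd S b f)) z" "isCont (pd S b (pd S a f)) z"
      using c continuous_on_interior z by blast+
  qed
qed

lemma pd_sum:
  assumes "finite I" "\<And>i. i \<in> I \<Longrightarrow> f i differentiable_on S" "z \<in> S"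
  shows "pd S v (\<lambda>y. \<Sum>i\<in>I. f i y) z = (\<Sum>i\<in>I. pd S v (f i) z)"
  by (rule pd_eqI[of _ "\<lambda>v. \<Sum>i\<in>I. pd S v (f i) z"])
    (use assms in \<open>auto intro!: has_derivative_sum has_derivative_pd\<close>)

end

section \<open>Smooth convex boundaries\<close>

lemma has_derivative_grad:
  assumes "f differentiable (at x)"
  shows "(f has_derivative (\<lambda>h. grad f x \<bullet> h)) (at x)"
proof -
  let ?D = "frechet_derivative f (at x)"
  have D: "(f has_derivative ?D) (at x)" using assms frechet_derivative_works by blast
  then interpret bounded_linear ?D by (rule has_derivative_bounded_linear)
  have "?D h = grad f x \<bullet> h" for h
  proof -
    have "?D h = ?D (\<Sum>b\<in>Basis. (h \<bullet> b) *\<^sub>R b)" by (simp add: euclidean_representation)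
    also have "\<dots> = (\<Sum>b\<in>Basis. (h \<bullet> b) * ?D b)" by (simp add: sum scaleR)
    also have "\<dots> = grad f x \<bullet> h"
      by (simp add: grad_def inner_sum_left inner_commute[of h] mult.commute)
    finally show ?thesis .
  qed
  then show ?thesis using D by presburger
qed

lemma smooth_on_UNIV_differentiable:
  assumes "smooth_on UNIV \<gamma>"
  shows "\<gamma> differentiable (at z)" "grad \<gamma> differentiable (at z)"
proof -
  have C: "Ck_on (Suc (Suc 0)) UNIV \<gamma>" using assms smooth_on_def by blast
  then show "\<gamma> differentiable (at z)" by (simp add: differentiable_on_def)
  have "(\<lambda>y. frechet_derivative \<gamma> (at y) b) differentiable (at z)" if "b \<in> Basis" for b
    using C that by (simp add: differentiable_on_def)
  then show "grad \<gamma> differentiable (at z)"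
    unfolding grad_def[abs_def] by (intro differentiable_sum differentiable_scaleR) auto
qed

context
  fixes \<gamma> :: "'a::euclidean_space \<Rightarrow> real" and e :: 'a
  assumes smooth: "smooth_on UNIV \<gamma>"
begin

lemma graph_fun_has_derivative:
  "(graph_fun e \<gamma> has_derivative
     (\<lambda>h. grad \<gamma> (y - (y \<bullet> e) *\<^sub>R e) \<bullet> (h - (h \<bullet> e) *\<^sub>R e) - h \<bullet> e)) (at y)"
proof -
  have "((\<lambda>y. \<gamma> (y - (y \<bullet> e) *\<^sub>R e)) has_derivative
     (\<lambda>h. grad \<gamma> (y - (y \<bullet> e) *\<^sub>R e) \<bullet> (h - (h \<bullet> e) *\<^sub>R e))) (at y)"
    by (rule has_derivative_compose[OF _ has_derivative_grad[OF smooth_on_UNIV_differentiable(1)[OF smooth]]])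
      (auto intro!: derivative_eq_intros)
  then show ?thesis
    unfolding graph_fun_def[abs_def] by (auto intro!: derivative_eq_intros)
qed

lemma grad_graph_fun_inner:
  "grad (graph_fun e \<gamma>) y \<bullet> h
     = grad \<gamma> (y - (y \<bullet> e) *\<^sub>R e) \<bullet> (h - (h \<bullet> e) *\<^sub>R e) - h \<bullet> e"
  using has_derivative_unique[OF has_derivative_grad graph_fun_has_derivative]
    graph_fun_has_derivative differentiableI by metis

lemma grad_graph_fun_differentiable: "grad (graph_fun e \<gamma>) differentiable (at y)"
proof -
  have "grad (graph_fun e \<gamma>) y
      = (\<Sum>b\<in>Basis. (grad \<gamma> (y - (y \<bullet> e) *\<^sub>R e) \<bullet> (b - (b \<bullet> e) *\<^sub>R e) - b \<bullet> e) *\<^sub>R b)" for y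
    by (subst euclidean_representation[symmetric]) (simp only: grad_graph_fun_inner)
  moreover have "(\<lambda>y. \<Sum>b\<in>Basis. (grad \<gamma> (y - (y \<bullet> e) *\<^sub>R e) \<bullet> (b - (b \<bullet> e) *\<^sub>R e) - b \<bullet> e) *\<^sub>R b)
      differentiable (at y)"
  proof (intro differentiable_sum differentiable_scaleR differentiable_diff differentiable_inner
      differentiable_const ballI finite_Basis)
    show "(\<lambda>y. grad \<gamma> (y - (y \<bullet> e) *\<^sub>R e)) differentiable (at y)"
      by (rule differentiable_compose[OF smooth_on_UNIV_differentiable(2)[OF smooth]])
        (intro differentiable_diff differentiable_scaleR differentiable_inner differentiable_ident
          differentiable_const)
  qed
  ultimately show ?thesis by presburger
qed

end

text \<open>\<open>N\<close> is the gradient of a single graph function, used at all nearby boundary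
  points and left unnormalised: it is then differentiable at once, and a condition on
  \<open>sgn (N y)\<close> passes to \<open>N y\<close> by linearity. The curves realise each
  tangent vector as a velocity along the boundary, and the last property provides a segment for
  inward one-sided derivatives.\<close>

lemma convex_smooth_boundary_normal:
  fixes \<Omega> :: "'a::euclidean_space set"
  assumes \<Omega>: "open \<Omega>" "convex \<Omega>" "smooth_boundary \<Omega>" and x: "x \<in> frontier \<Omega>"
  obtains r N where "r > 0" "N differentiable (at x)"
    "\<And>y. y \<in> frontier \<Omega> \<Longrightarrow> y \<in> ball x r \<Longrightarrow> N y \<noteq> 0 \<and> outward_unit_normal \<Omega> y (sgn (N y))"
    "\<And>y z. y \<in> frontier \<Omega> \<Longrightarrow> y \<in> ball x r \<Longrightarrow> z \<in> closure \<Omega> \<Longrightarrow> N y \<bullet> (z - y) \<le> 0"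
    "\<And>p. p \<bullet> N x = 0 \<Longrightarrow> \<exists>c. c 0 = x \<and> (c has_vector_derivative p) (at 0) \<and>
        (\<forall>\<^sub>F s in at 0. c s \<in> frontier \<Omega>)"
    "\<exists>\<delta>>0. \<forall>\<theta>. 0 < \<theta> \<and> \<theta> < \<delta> \<longrightarrow> x - \<theta> *\<^sub>R N x \<in> \<Omega>"
proof -
  obtain r e \<gamma> where bg: "boundary_graph \<Omega> x r e \<gamma>"
    using \<Omega>(3) x smooth_boundary_def by blast
  then have r: "r > 0" and e: "norm e = 1" and smooth: "smooth_on UNIV \<gamma>"
    and graph: "\<Omega> \<inter> ball x r = {y \<in> ball x r. graph_fun e \<gamma> y < 0}"
    by (auto simp: boundary_graph_def)
  have ee: "e \<bullet> e = 1" using e by (simp add: dot_square_norm)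
  define G where "G = graph_fun e \<gamma>"
  define N where "N = grad G"
  have Gd: "(G has_derivative (\<lambda>h. N y \<bullet> h)) (at y)" for y
    unfolding G_def N_def
    using graph_fun_has_derivative[OF smooth] differentiableI has_derivative_grad by blast
  then have Gc: "continuous_on UNIV G" by (meson continuous_at_imp_continuous_on has_derivative_continuous)
  have graphG: "y \<in> \<Omega> \<longleftrightarrow> G y < 0" if "y \<in> ball x r" for y
    using graph that unfolding G_def by blast
  have Ne: "N y \<bullet> e = -1" for y
    unfolding N_def G_def grad_graph_fun_inner[OF smooth] using ee by simp
  have closure_le: "G y \<le> 0" if "y \<in> closure \<Omega>" "y \<in> ball x r" for y
  proof -
    have "y \<in> closure (\<Omega> \<inter> ball x r)"
      using that by (metis IntI Int_commute open_Int_closure_subset open_ball subsetD)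
    moreover have "closure (\<Omega> \<inter> ball x r) \<subseteq> {y. G y \<le> 0}"
    proof (rule closure_minimal)
      show "\<Omega> \<inter> ball x r \<subseteq> {y. G y \<le> 0}" using graphG by auto
      show "closed {y. G y \<le> 0}" using Gc by (intro closed_Collect_le) auto
    qed
    ultimately show ?thesis by blast
  qed
  have frontier_eq: "y \<in> frontier \<Omega> \<longleftrightarrow> G y = 0" if y: "y \<in> ball x r" for y
  proof
    assume "y \<in> frontier \<Omega>"
    then have "y \<in> closure \<Omega>" "y \<notin> \<Omega>" using \<Omega>(1) by (auto simp: frontier_def interior_open)
    then show "G y = 0" using closure_le[OF _ y] graphG[OF y] by force
  next
    assume G0: "G y = 0"
    have "y \<in> closure \<Omega>"
    proof (rule Lim_in_closed_set[OF closed_closure])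
      show "((\<lambda>\<delta>. y + \<delta> *\<^sub>R e) \<longlongrightarrow> y) (at_right 0)" by (auto intro!: tendsto_eq_intros)
      then have "\<forall>\<^sub>F \<delta> in at_right 0. y + \<delta> *\<^sub>R e \<in> ball x r"
        using y open_ball topological_tendstoD by blast
      moreover have "\<forall>\<^sub>F \<delta> in at_right 0. (0::real) < \<delta>" by (simp add: eventually_at_right_less)
      ultimately show "\<forall>\<^sub>F \<delta> in at_right 0. y + \<delta> *\<^sub>R e \<in> closure \<Omega>"
      proof eventually_elim
        case (elim \<delta>)
        have "G (y + \<delta> *\<^sub>R e) = G y - \<delta>"
          by (simp add: G_def graph_fun_def inner_add_left ee algebra_simps)
        then have "y + \<delta> *\<^sub>R e \<in> \<Omega>" using graphG[OF elim(1)] elim(2) G0 by simp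
        then show ?case using closure_subset by blast
      qed
    qed simp
    moreover have "y \<notin> \<Omega>" using graphG[OF y] G0 by simp
    ultimately show "y \<in> frontier \<Omega>" using \<Omega>(1) by (simp add: frontier_def interior_open)
  qed
  have line: "((\<lambda>\<theta>. G (y + \<theta> *\<^sub>R v)) has_real_derivative N y \<bullet> v) (at 0)" for y v
    using has_derivative_along_line[OF Gd, of UNIV y v] by simp
  show ?thesis
  proof (rule that[OF r])
    show "N differentiable (at x)"
      unfolding N_def G_def by (rule grad_graph_fun_differentiable[OF smooth])
  next
    fix y assume y: "y \<in> frontier \<Omega>" "y \<in> ball x r"
    \<comment> \<open>The same graph represents the boundary around \<open>y\<close> once the radius
      is shrunk to stay inside \<open>ball x r\<close>.\<close>
    define r' where "r' = r - dist x y"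
    have "ball y r' \<subseteq> ball x r" by (simp add: r'_def ball_subset_ball_iff dist_commute)
    then have "boundary_graph \<Omega> y r' e \<gamma>"
      using y(2) e smooth graphG unfolding boundary_graph_def G_def[symmetric] by (auto simp: r'_def)
    then have "outward_unit_normal \<Omega> y (sgn (N y))"
      unfolding outward_unit_normal_def N_def G_def by blast
    moreover have "N y \<noteq> 0" using Ne[of y] by auto
    ultimately show "N y \<noteq> 0 \<and> outward_unit_normal \<Omega> y (sgn (N y))" by blast
  next
    fix y z assume y: "y \<in> frontier \<Omega>" "y \<in> ball x r" and z: "z \<in> closure \<Omega>"
    show "N y \<bullet> (z - y) \<le> 0"
    proof (rule ccontr)
      assume "\<not> N y \<bullet> (z - y) \<le> 0"
      \<comment> \<open>\<open>G\<close> vanishes at \<open>y\<close>, so a positive slope towards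
        \<open>z\<close> would make it positive on a segment that convexity keeps in the closure,
        where \<open>G\<close> is at most 0.\<close>
      then obtain d where d: "d > 0" "\<And>h. 0 < h \<Longrightarrow> h < d \<Longrightarrow> G y < G (y + h *\<^sub>R (z - y))"
        using DERIV_pos_inc_right[OF line[of y "z - y"]] by auto
      have "((\<lambda>h. y + h *\<^sub>R (z - y)) \<longlongrightarrow> y) (at_right 0)" by (auto intro!: tendsto_eq_intros)
      then have 1: "\<forall>\<^sub>F h in at_right 0. y + h *\<^sub>R (z - y) \<in> ball x r"
        using y open_ball topological_tendstoD by blast
      have 2: "\<forall>\<^sub>F h in at_right (0::real). 0 < h \<and> h < min 1 d"
        using d by (intro eventually_at_rightI[of 0 "min 1 d"]) auto
      obtain h where h: "y + h *\<^sub>R (z - y) \<in> ball x r" "0 < h" "h < min 1 d"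
        using eventually_happens'[OF _ eventually_conj[OF 1 2]] by auto
      have "y \<in> closure \<Omega>" using y by (simp add: frontier_def)
      then have "(1 - h) *\<^sub>R y + h *\<^sub>R z \<in> closure \<Omega>"
        using convex_closure[OF \<Omega>(2)] z h by (intro convexD) auto
      then have "y + h *\<^sub>R (z - y) \<in> closure \<Omega>" by (simp add: algebra_simps)
      then show False using closure_le h d(2)[of h] frontier_eq y by force
    qed
  next
    have Gx: "G x = 0" using frontier_eq[of x] x r by simp
    define P where "P y = y - (y \<bullet> e) *\<^sub>R e" for y
    have Gx': "\<gamma> (P x) = x \<bullet> e" using Gx by (simp add: G_def graph_fun_def P_def)
    fix p assume p: "p \<bullet> N x = 0"
    define q where "q = P p"
    have qe: "q \<bullet> e = 0" by (simp add: q_def P_def inner_diff_left ee)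
    \<comment> \<open>The straight line through \<open>P x\<close> with direction \<open>q\<close>,
      lifted to the graph of \<open>\<gamma>\<close>. Its velocity is \<open>q\<close> plus a
      multiple of \<open>e\<close>, and orthogonality of \<open>p\<close> to \<open>N x\<close> says
      exactly that this multiple is \<open>p \<bullet> e\<close>.\<close>
    define c where "c s = x + s *\<^sub>R q + (\<gamma> (P x + s *\<^sub>R q) - \<gamma> (P x)) *\<^sub>R e" for s
    have c0: "c 0 = x" by (simp add: c_def)
    have "((\<lambda>s. \<gamma> (P x + s *\<^sub>R q)) has_real_derivative grad \<gamma> (P x) \<bullet> q) (at 0)"
      using has_derivative_along_line[OF has_derivative_grad[OF smooth_on_UNIV_differentiable(1)[OF smooth]], of UNIV]
      by simp
    then have "(c has_vector_derivative q + (grad \<gamma> (P x) \<bullet> q) *\<^sub>R e) (at 0)"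
      unfolding c_def[abs_def] by (auto intro!: derivative_eq_intros)
    moreover have "N x \<bullet> p = 0" using p by (simp add: inner_commute)
    then have "grad \<gamma> (P x) \<bullet> q = p \<bullet> e"
      unfolding N_def G_def grad_graph_fun_inner[OF smooth] by (simp add: q_def P_def)
    then have "q + (grad \<gamma> (P x) \<bullet> q) *\<^sub>R e = p" by (simp add: q_def P_def)
    ultimately have c: "(c has_vector_derivative p) (at 0)" by simp
    have "(c \<longlongrightarrow> x) (at 0)"
      using has_vector_derivative_continuous[OF c] c0 by (simp add: continuous_within)
    then have "\<forall>\<^sub>F s in at 0. c s \<in> ball x r" using r by (intro topological_tendstoD) auto
    then have "\<forall>\<^sub>F s in at 0. c s \<in> frontier \<Omega>"
    proof eventually_elim
      case (elim s)
      have ce: "c s \<bullet> e = \<gamma> (P x + s *\<^sub>R q)"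
        using Gx' by (simp add: c_def inner_add_left qe ee)
      have "P (c s) = P x + s *\<^sub>R q"
        by (simp add: P_def c_def inner_add_left qe ee algebra_simps)
      then have "G (c s) = 0" using ce by (simp add: G_def graph_fun_def P_def)
      then show ?case using frontier_eq[OF elim] by simp
    qed
    then show "\<exists>c. c 0 = x \<and> (c has_vector_derivative p) (at 0) \<and> (\<forall>\<^sub>F s in at 0. c s \<in> frontier \<Omega>)"
      using c c0 by blast
  next
    have Gx: "G x = 0" using frontier_eq[of x] x r by simp
    have "N x \<noteq> 0" using Ne[of x] by auto
    then have "N x \<bullet> (- N x) < 0" by simp
    then obtain d where d: "d > 0" "\<And>h. 0 < h \<Longrightarrow> h < d \<Longrightarrow> G (x + h *\<^sub>R (- N x)) < G x"
      using DERIV_neg_dec_right[OF line[of x "- N x"]] by auto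
    have "((\<lambda>h. x + h *\<^sub>R (- N x)) \<longlongrightarrow> x) (at_right 0)" by (auto intro!: tendsto_eq_intros)
    then have "\<forall>\<^sub>F h in at_right 0. x + h *\<^sub>R (- N x) \<in> ball x r"
      using r by (intro topological_tendstoD) auto
    then obtain b where b: "b > 0" "\<And>h. 0 < h \<Longrightarrow> h < b \<Longrightarrow> x + h *\<^sub>R (- N x) \<in> ball x r"
      unfolding eventually_at_right_field by auto
    show "\<exists>\<delta>>0. \<forall>\<theta>. 0 < \<theta> \<and> \<theta> < \<delta> \<longrightarrow> x - \<theta> *\<^sub>R N x \<in> \<Omega>"
    proof (intro exI[of _ "min d b"] conjI allI impI)
      fix \<theta> assume "0 < \<theta> \<and> \<theta> < min d b"
      then have "x + \<theta> *\<^sub>R (- N x) \<in> \<Omega>" using graphG b(2) d(2) Gx by simp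
      then show "x - \<theta> *\<^sub>R N x \<in> \<Omega>" by simp
    qed (use d b in simp)
  qed
qed

section \<open>Derivatives of Neumann heat solutions\<close>

lemma has_vector_derivative_at_0_quotient:
  fixes f :: "real \<Rightarrow> 'a::euclidean_space"
  assumes "(f has_vector_derivative D) (at 0)"
  shows "((\<lambda>s. (f s - f 0) /\<^sub>R s) \<longlongrightarrow> D) (at 0)"
  unfolding tendsto_componentwise_iff[of _ D]
proof
  fix b :: 'a
  have "((\<lambda>s. f s \<bullet> b) has_real_derivative D \<bullet> b) (at 0)"
    unfolding has_real_derivative_iff_has_vector_derivative
    by (rule bounded_linear.has_vector_derivative[OF bounded_linear_inner_left assms])
  then show "((\<lambda>s. ((f s - f 0) /\<^sub>R s) \<bullet> b) \<longlongrightarrow> D \<bullet> b) (at 0)"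
    by (simp add: DERIV_def inner_diff_left divide_inverse mult.commute)
qed

text \<open>The inner product of the two difference quotients is \<open>1 / s^2\<close> times a
  nonnegative number. With \<open>f\<close> the normal field along a boundary curve
  \<open>g\<close>, this is nonnegativity of the curvature of a convex boundary.\<close>

lemma monotone_derivative_inner_nonneg:
  fixes f g :: "real \<Rightarrow> 'a::euclidean_space"
  assumes "(f has_vector_derivative F) (at 0)" "(g has_vector_derivative G) (at 0)"
    and "\<forall>\<^sub>F s in at 0. (f s - f 0) \<bullet> (g s - g 0) \<ge> 0"
  shows "F \<bullet> G \<ge> 0"
proof (rule tendsto_lowerbound)
  show "((\<lambda>s. ((f s - f 0) /\<^sub>R s) \<bullet> ((g s - g 0) /\<^sub>R s)) \<longlongrightarrow> F \<bullet> G) (at 0)"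
    using assms by (intro tendsto_inner has_vector_derivative_at_0_quotient)
  show "\<forall>\<^sub>F s in at 0. 0 \<le> ((f s - f 0) /\<^sub>R s) \<bullet> ((g s - g 0) /\<^sub>R s)"
    using assms(3)
  proof eventually_elim
    case (elim s)
    have "((f s - f 0) /\<^sub>R s) \<bullet> ((g s - g 0) /\<^sub>R s) = (inverse s)\<^sup>2 * ((f s - f 0) \<bullet> (g s - g 0))"
      by (simp add: power2_eq_square)
    then show ?case using elim by (simp only: zero_le_mult_iff zero_le_power2 simp_thms)
  qed
qed simp

locale neumann_heat =
  fixes \<Omega> :: "'a::euclidean_space set" and T :: real and u :: "'a \<Rightarrow> real \<Rightarrow> real"
  assumes open_\<Omega>: "open \<Omega>" and convex_\<Omega>: "convex \<Omega>" and nonempty_\<Omega>: "\<Omega> \<noteq> {}"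
    and smooth_boundary_\<Omega>: "smooth_boundary \<Omega>" and T: "T > 0"
    and solution: "neumann_heat_solution \<Omega> T u"
begin

text \<open>Contains the lateral boundary but is open at both ends in time: at \<open>t = 0\<close>
  the solution is only continuous.\<close>

definition S :: "('a \<times> real) set" where "S = closure \<Omega> \<times> {0<..<T}"

definition U :: "'a \<times> real \<Rightarrow> real" where "U = (\<lambda>(x, t). u x t)"

abbreviation D :: "'a \<Rightarrow> ('a \<times> real \<Rightarrow> real) \<Rightarrow> 'a \<times> real \<Rightarrow> real" where
  "D v \<equiv> pd S (v, 0)"

abbreviation Dt :: "('a \<times> real \<Rightarrow> real) \<Rightarrow> 'a \<times> real \<Rightarrow> real" where
  "Dt \<equiv> pd S (0, 1)"

lemma mem_S: "(x, t) \<in> S \<longleftrightarrow> x \<in> closure \<Omega> \<and> 0 < t \<and> t < T"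
  by (simp add: S_def)

lemma interior_closure_\<Omega>: "interior (closure \<Omega>) = \<Omega>"
  using convex_interior_closure[OF convex_\<Omega>] open_\<Omega> by (simp add: interior_open)

lemma interior_S_eq: "interior S = \<Omega> \<times> {0<..<T}"
  by (simp add: S_def interior_Times interior_closure_\<Omega> interior_open)

sublocale convex_body S
proof
  show "convex S" unfolding S_def by (intro convex_Times convex_closure convex_\<Omega> convex_real_interval)
  show "interior S \<noteq> {}" using nonempty_\<Omega> T by (simp add: interior_S_eq)
qed

lemma Basis_prod: "i \<in> Basis \<Longrightarrow> (i, 0 :: real) \<in> Basis" "(0 :: 'a, 1 :: real) \<in> Basis"
  by (auto simp: Basis_prod_def)

lemma smooth_U: "smooth_on S U"
  using solution by (simp add: neumann_heat_solution_def S_def U_def)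

lemma smooth_D [simp, intro]: "smooth_on S f \<Longrightarrow> i \<in> Basis \<Longrightarrow> smooth_on S (D i f)"
  and smooth_Dt [simp, intro]: "smooth_on S f \<Longrightarrow> smooth_on S (Dt f)"
  by (auto intro: smooth_on_imp(3) Basis_prod)

lemma D_commute:
  assumes "smooth_on S f" "z \<in> S" "i \<in> Basis"
  shows "j \<in> Basis \<Longrightarrow> D i (D j f) z = D j (D i f) z" "Dt (D i f) z = D i (Dt f) z"
  using pd_commute[OF assms(1) _ _ assms(2)] Basis_prod assms(3) by blast+

lemma D_expand:
  assumes "f differentiable_on S" "z \<in> S"
  shows "D v f z = (\<Sum>i\<in>Basis. (v \<bullet> i) * D i f z)"
proof -
  have "linear (\<lambda>v::'a. (v, 0::real))" by (rule linearI) auto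
  then interpret D: linear "\<lambda>v. D v f z"
    using linear_compose[OF _ pd_linear[OF assms]] by (simp add: o_def)
  have "D (\<Sum>i\<in>Basis. (v \<bullet> i) *\<^sub>R i) f z = (\<Sum>i\<in>Basis. (v \<bullet> i) * D i f z)"
    by (simp add: D.sum D.scale)
  then show ?thesis by (simp add: euclidean_representation)
qed

section \<open>Derivatives of spatial and temporal slices\<close>

lemma has_derivative_slice:
  assumes "f differentiable_on S" "(x, t) \<in> S"
  shows "((\<lambda>y. f (y, t)) has_derivative (\<lambda>v. D v f (x, t))) (at x within closure \<Omega>)"
proof (rule has_derivative_in_compose[of "\<lambda>y. (y, t)" "\<lambda>v. (v, 0)" x "closure \<Omega>" f])
  show "((\<lambda>y. (y, t)) has_derivative (\<lambda>v. (v, 0))) (at x within closure \<Omega>)"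
    by (auto intro!: derivative_eq_intros)
  show "(f has_derivative (\<lambda>v. pd S v f (x, t))) (at (x, t) within (\<lambda>y. (y, t)) ` closure \<Omega>)"
    by (rule has_derivative_subset[OF has_derivative_pd[OF assms]]) (use assms in \<open>auto simp: mem_S\<close>)
qed

lemma has_derivative_slice_interior:
  assumes "f differentiable_on S" "x \<in> \<Omega>" "t \<in> {0<..<T}"
  shows "((\<lambda>y. f (y, t)) has_derivative (\<lambda>v. D v f (x, t))) (at x)"
proof -
  have "x \<in> closure \<Omega>" using assms(2) closure_subset by blast
  then have "((\<lambda>y. f (y, t)) has_derivative (\<lambda>v. D v f (x, t))) (at x within closure \<Omega>)"
    using assms by (intro has_derivative_slice) (auto simp: mem_S)
  moreover have "at x within closure \<Omega> = at x"
    by (rule at_within_interior) (use assms(2) in \<open>simp only: interior_closure_\<Omega>\<close>)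
  ultimately show ?thesis by simp
qed

lemma has_derivative_time:
  assumes "f differentiable_on S" "(x, t) \<in> S"
  shows "((\<lambda>s. f (x, s)) has_real_derivative Dt f (x, t)) (at t)"
proof -
  have "((\<lambda>s. f ((x, t) + s *\<^sub>R (0, 1))) has_real_derivative Dt f (x, t)) (at 0 within {-t<..<T-t})"
    by (rule has_derivative_along_line[OF has_derivative_pd[OF assms]]) (use assms(2) in \<open>auto simp: mem_S\<close>)
  moreover have "at 0 within {-t<..<T-t} = at 0"
    using assms(2) by (intro at_within_open) (auto simp: mem_S)
  ultimately have "((\<lambda>s. f (x, s + t)) has_real_derivative Dt f (x, t)) (at 0)"
    by (simp add: add.commute)
  then show ?thesis using DERIV_shift[of "\<lambda>s. f (x, s)" "Dt f (x, t)" 0 t] by simp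
qed

lemma frechet_derivative_slice:
  assumes "f differentiable_on S" "x \<in> \<Omega>" "t \<in> {0<..<T}"
  shows "frechet_derivative (\<lambda>y. f (y, t)) (at x) = (\<lambda>v. D v f (x, t))"
  using frechet_derivative_at[OF has_derivative_slice_interior[OF assms]] by simp

lemma frechet_derivative_slice2:
  assumes "smooth_on S f" "b \<in> Basis" "x \<in> \<Omega>" "t \<in> {0<..<T}"
  shows "frechet_derivative (\<lambda>y. frechet_derivative (\<lambda>y. f (y, t)) (at y) b) (at x) v = D v (D b f) (x, t)"
proof -
  have f: "D b f differentiable_on S" "f differentiable_on S"
    using assms by (auto intro: smooth_on_imp)
  have "frechet_derivative (\<lambda>y. D b f (y, t)) (at x)
      = frechet_derivative (\<lambda>y. frechet_derivative (\<lambda>y. f (y, t)) (at y) b) (at x)"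
    using has_derivative_slice_interior[OF f(1) assms(3,4)] frechet_derivative_slice[OF f(2) _ assms(4)]
    by (intro frechet_derivative_transform_within_open[OF _ open_\<Omega> assms(3)]) (auto simp: differentiable_def)
  then show ?thesis using frechet_derivative_slice[OF f(1) assms(3,4)] by metis
qed

lemma laplacian_slice:
  assumes "x \<in> \<Omega>" "t \<in> {0<..<T}"
  shows "laplacian (\<lambda>y. u y t) x = (\<Sum>i\<in>Basis. D i (D i U) (x, t))"
  unfolding laplacian_def
  using frechet_derivative_slice2[OF smooth_U _ assms] by (simp add: U_def)

lemma grad_slice:
  assumes "x \<in> \<Omega>" "t \<in> {0<..<T}"
  shows "grad (\<lambda>y. u y t) x = (\<Sum>i\<in>Basis. D i U (x, t) *\<^sub>R i)"
  unfolding grad_def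
  using frechet_derivative_slice[OF smooth_on_imp(2)[OF smooth_U] assms] by (simp add: U_def)

text \<open>Continuity carries the equation to the lateral boundary. Having it on all of
  \<open>S\<close> allows it to be differentiated within \<open>S\<close>.\<close>

lemma heat_equation:
  assumes "z \<in> S"
  shows "Dt U z = (\<Sum>i\<in>Basis. D i (D i U) z)"
proof (rule eq_on_closure[OF _ _ _ assms])
  show "continuous_on S (Dt U)" using smooth_U smooth_on_imp by blast
  show "continuous_on S (\<lambda>z. \<Sum>i\<in>Basis. D i (D i U) z)"
    using smooth_U smooth_on_imp(1) by (intro continuous_on_sum) blast
  fix z assume "z \<in> interior S"
  then obtain x t where z: "z = (x, t)" "x \<in> \<Omega>" "t \<in> {0<..<T}" by (auto simp: interior_S_eq)
  have "(x, t) \<in> S" using z closure_subset by (auto simp: mem_S)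
  then have "((\<lambda>s. u x s) has_real_derivative Dt U (x, t)) (at t)"
    using has_derivative_time[OF smooth_on_imp(2)[OF smooth_U]] by (simp add: U_def)
  then have "deriv (\<lambda>s. u x s) t = Dt U z" using z DERIV_imp_deriv by blast
  then show "Dt U z = (\<Sum>i\<in>Basis. D i (D i U) z)"
    using solution z laplacian_slice[of x t] by (simp add: neumann_heat_solution_def)
qed

text \<open>For the last claim, differentiate \<open>D u \<bullet> N = 0\<close> along a boundary curve with velocity \<open>D u\<close>: this
  turns \<open>D\<^sup>2 u (D u, N)\<close> into \<open>- N' (D u) \<bullet> D u\<close>, and the (unnormalised) normal field \<open>N\<close> of a convex set is
  monotone.\<close>

lemma boundary_normal:
  assumes x: "x \<in> frontier \<Omega>"
  obtains N where "N \<noteq> 0" "\<And>z. z \<in> closure \<Omega> \<Longrightarrow> N \<bullet> (z - x) \<le> 0"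
    "\<exists>\<delta>>0. \<forall>\<theta>. 0 < \<theta> \<and> \<theta> < \<delta> \<longrightarrow> x - \<theta> *\<^sub>R N \<in> \<Omega>"
    "\<And>t. t \<in> {0<..<T} \<Longrightarrow> D N U (x, t) = 0"
    "\<And>t. t \<in> {0<..<T} \<Longrightarrow> D N (Dt U) (x, t) = 0"
    "\<And>t. t \<in> {0<..<T} \<Longrightarrow> (\<Sum>i\<in>Basis. D i U (x, t) * D N (D i U) (x, t)) \<le> 0"
proof -
  obtain r N where r: "r > 0" and N: "N differentiable (at x)"
    and nu: "\<And>y. y \<in> frontier \<Omega> \<Longrightarrow> y \<in> ball x r \<Longrightarrow> N y \<noteq> 0 \<and> outward_unit_normal \<Omega> y (sgn (N y))"
    and supp: "\<And>y z. y \<in> frontier \<Omega> \<Longrightarrow> y \<in> ball x r \<Longrightarrow> z \<in> closure \<Omega> \<Longrightarrow> N y \<bullet> (z - y) \<le> 0"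
    and curve: "\<And>p. p \<bullet> N x = 0 \<Longrightarrow> \<exists>c. c 0 = x \<and> (c has_vector_derivative p) (at 0) \<and>
        (\<forall>\<^sub>F s in at 0. c s \<in> frontier \<Omega>)"
    and inw: "\<exists>\<delta>>0. \<forall>\<theta>. 0 < \<theta> \<and> \<theta> < \<delta> \<longrightarrow> x - \<theta> *\<^sub>R N x \<in> \<Omega>"
    using convex_smooth_boundary_normal[OF open_\<Omega> convex_\<Omega> smooth_boundary_\<Omega> x] by blast
  have fc: "y \<in> closure \<Omega>" if "y \<in> frontier \<Omega>" for y using that by (simp add: frontier_def)
  note sm = smooth_U smooth_D[OF smooth_U] smooth_Dt[OF smooth_U]
  note dif = smooth_on_imp(2)[OF sm(1)] smooth_on_imp(2)[OF sm(2)] smooth_on_imp(2)[OF sm(3)]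
  \<comment> \<open>The boundary condition concerns the \<open>frechet_derivative\<close> of a slice
    within \<open>closure \<Omega>\<close> in a unit direction; uniqueness identifies it with
    \<open>D\<close>, and linearity removes the normalisation.\<close>
  have Neumann: "D (N y) U (y, t) = 0" if y: "y \<in> frontier \<Omega>" "y \<in> ball x r" and t: "t \<in> {0<..<T}" for y t
  proof -
    have yt: "(y, t) \<in> S" using y t fc by (simp add: mem_S)
    have d: "((\<lambda>y. u y t) has_derivative (\<lambda>v. D v U (y, t))) (at y within closure \<Omega>)"
      using has_derivative_slice[OF dif(1) yt] by (simp add: U_def)
    have "frechet_derivative (\<lambda>y. u y t) (at y within closure \<Omega>) = (\<lambda>v. D v U (y, t))"
    proof (rule convex_has_derivative_unique[OF convex_closure[OF convex_\<Omega>] _ fc[OF y(1)] _ d])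
      show "interior (closure \<Omega>) \<noteq> {}" using nonempty_\<Omega> by (simp add: interior_closure_\<Omega>)
      show "((\<lambda>y. u y t) has_derivative frechet_derivative (\<lambda>y. u y t) (at y within closure \<Omega>))
          (at y within closure \<Omega>)"
        using d differentiableI frechet_derivative_works by blast
    qed
    moreover have "frechet_derivative (\<lambda>y. u y t) (at y within closure \<Omega>) (sgn (N y)) = 0"
      using solution y(1) t nu[OF y] unfolding neumann_heat_solution_def by blast
    ultimately have "D (sgn (N y)) U (y, t) = 0" by simp
    moreover interpret linear "\<lambda>v. pd S v U (y, t)" using pd_linear[OF dif(1) yt] .
    have "D (sgn (N y)) U (y, t) = inverse (norm (N y)) * D (N y) U (y, t)"
      using scale[of _ "(N y, 0)"] by (simp add: sgn_div_norm)
    ultimately show ?thesis using nu[OF y] by simp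
  qed
  have xr: "x \<in> ball x r" using r by simp
  show ?thesis
  proof (rule that[of "N x"])
    show "N x \<noteq> 0" using nu[OF x xr] by blast
    show "\<And>z. z \<in> closure \<Omega> \<Longrightarrow> N x \<bullet> (z - x) \<le> 0" using supp[OF x xr] by blast
    show "\<exists>\<delta>>0. \<forall>\<theta>. 0 < \<theta> \<and> \<theta> < \<delta> \<longrightarrow> x - \<theta> *\<^sub>R N x \<in> \<Omega>" by (rule inw)
    show N0: "D (N x) U (x, t) = 0" if "t \<in> {0<..<T}" for t using Neumann[OF x xr that] .
    fix t assume t: "t \<in> {0<..<T}"
    have xt: "(x, s) \<in> S" if "s \<in> {0<..<T}" for s using fc[OF x] that by (simp add: mem_S)
    \<comment> \<open>The normal at \<open>x\<close> does not depend on time, so the Neumann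
      condition can be differentiated in \<open>t\<close> and the derivatives exchanged.\<close>
    show "D (N x) (Dt U) (x, t) = 0"
    proof -
      have der: "((\<lambda>s. \<Sum>i\<in>Basis. (N x \<bullet> i) * D i U (x, s)) has_real_derivative
          (\<Sum>i\<in>Basis. (N x \<bullet> i) * Dt (D i U) (x, t))) (at t)"
        by (intro DERIV_sum DERIV_cmult has_derivative_time[OF dif(2) xt[OF t]])
      have zero: "(\<Sum>i\<in>Basis. (N x \<bullet> i) * D i U (x, s)) = 0" if "s \<in> {0<..<T}" for s
        by (rule trans[OF D_expand[OF dif(1) xt[OF that], symmetric] N0[OF that]])
      have "((\<lambda>s. 0) has_real_derivative
          (\<Sum>i\<in>Basis. (N x \<bullet> i) * Dt (D i U) (x, t))) (at t)"
        by (rule has_field_derivative_transform_within_open[OF der open_greaterThanLessThan t zero])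
      then have "(\<Sum>i\<in>Basis. (N x \<bullet> i) * Dt (D i U) (x, t)) = 0"
        using DERIV_const DERIV_unique by blast
      then have "(\<Sum>i\<in>Basis. (N x \<bullet> i) * D i (Dt U) (x, t)) = 0"
        by (simp add: D_commute(2)[OF smooth_U xt[OF t]])
      then show ?thesis by (rule trans[OF D_expand[OF dif(3) xt[OF t]]])
    qed
    \<comment> \<open>The spatial gradient. The Neumann condition makes it tangential, so some
      boundary curve has it as velocity.\<close>
    define p where "p = (\<Sum>i\<in>Basis. D i U (x, t) *\<^sub>R i)"
    have pi: "p \<bullet> i = D i U (x, t)" if "i \<in> Basis" for i using that by (simp add: p_def)
    have "p \<bullet> N x = D (N x) U (x, t)"
      unfolding euclidean_inner[of p "N x"]
      by (rule trans[OF _ D_expand[OF dif(1) xt[OF t], symmetric]]) (simp add: pi mult.commute)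
    then have "p \<bullet> N x = 0" using N0[OF t] by simp
    then obtain c where c0: "c 0 = x" and c: "(c has_vector_derivative p) (at 0)"
      and cf: "\<forall>\<^sub>F s in at 0. c s \<in> frontier \<Omega>" using curve by blast
    have "(c \<longlongrightarrow> x) (at 0)"
      using has_vector_derivative_continuous[OF c] c0 by (simp add: continuous_within)
    then have "\<forall>\<^sub>F s in at 0. c s \<in> ball x r" using r by (intro topological_tendstoD) auto
    with cf have "\<forall>\<^sub>F s in at 0. c s \<in> frontier \<Omega> \<and> c s \<in> ball x r" by (rule eventually_conj)
    then obtain d where d: "d > 0" "\<And>s. s \<noteq> 0 \<Longrightarrow> \<bar>s\<bar> < d \<Longrightarrow> c s \<in> frontier \<Omega> \<and> c s \<in> ball x r"
      by (auto simp: eventually_at)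
    \<comment> \<open>\<open>D i U\<close> is known to be differentiable only within
      \<open>S\<close>. Over the open interval \<open>J\<close> the curve stays in the boundary, so
      the chain rule within \<open>J\<close> applies and yields a two-sided derivative at 0.\<close>
    define J where "J = {-d<..<d}"
    have J: "open J" "0 \<in> J" using d by (auto simp: J_def)
    have cJ: "c s \<in> frontier \<Omega>" "c s \<in> ball x r" if "s \<in> J" for s
      using d(2)[of s] that x xr c0 by (cases "s = 0"; force simp: J_def)+
    obtain N' where N': "(N has_derivative N') (at x)" using N differentiable_def by blast
    define M where "M = N' p"
    have Nc: "((\<lambda>s. N (c s)) has_vector_derivative M) (at 0)"
      using has_derivative_compose[OF c[unfolded has_vector_derivative_def] N'[folded c0]]
        linear_scale[OF has_derivative_linear[OF N']]
      by (simp add: has_vector_derivative_def M_def)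
    have Dc: "((\<lambda>s. D i U (c s, t)) has_real_derivative D p (D i U) (x, t)) (at 0)" if i: "i \<in> Basis" for i
    proof -
      interpret linear "\<lambda>v. pd S v (D i U) (x, t)" using pd_linear[OF dif(2)[OF i] xt[OF t]] .
      have "((\<lambda>s. (c s, t)) has_derivative (\<lambda>s. (s *\<^sub>R p, 0))) (at 0 within J)"
        using c unfolding has_vector_derivative_def
        by (auto intro!: derivative_eq_intros intro: has_derivative_at_withinI)
      moreover have "(D i U has_derivative (\<lambda>v. pd S v (D i U) (x, t)))
          (at (c 0, t) within (\<lambda>s. (c s, t)) ` J)"
        unfolding c0
        by (rule has_derivative_subset[OF has_derivative_pd[OF dif(2)[OF i] xt[OF t]]])
          (use cJ t fc in \<open>auto simp: mem_S\<close>)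
      ultimately have "((\<lambda>s. D i U (c s, t)) has_derivative
          (\<lambda>s. pd S (s *\<^sub>R p, 0) (D i U) (x, t))) (at 0 within J)"
        by (rule has_derivative_in_compose)
      moreover have "pd S (s *\<^sub>R p, 0) (D i U) (x, t) = s * D p (D i U) (x, t)" for s
        using scale[of s "(p, 0)"] by simp
      ultimately show ?thesis
        using at_within_open[OF J(2,1)] by (simp add: has_field_derivative_def mult_commute_abs)
    qed
    have der: "((\<lambda>s. \<Sum>i\<in>Basis. (N (c s) \<bullet> i) * D i U (c s, t)) has_real_derivative
        (\<Sum>i\<in>Basis. (M \<bullet> i) * D i U (x, t) + D p (D i U) (x, t) * (N x \<bullet> i))) (at 0)"
    proof (rule DERIV_sum)
      fix i :: 'a assume i: "i \<in> Basis"
      have "((\<lambda>s. N (c s) \<bullet> i) has_real_derivative M \<bullet> i) (at 0)"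
        unfolding has_real_derivative_iff_has_vector_derivative
        by (rule bounded_linear.has_vector_derivative[OF bounded_linear_inner_left Nc])
      from DERIV_mult[OF this Dc[OF i]]
      show "((\<lambda>s. (N (c s) \<bullet> i) * D i U (c s, t)) has_real_derivative
          (M \<bullet> i) * D i U (x, t) + D p (D i U) (x, t) * (N x \<bullet> i)) (at 0)"
        by (simp add: c0)
    qed
    \<comment> \<open>The Neumann condition at every point of the curve; the derivative computed in
      \<open>der\<close> must therefore vanish.\<close>
    have zero: "(\<Sum>i\<in>Basis. (N (c s) \<bullet> i) * D i U (c s, t)) = 0" if "s \<in> J" for s
    proof -
      have "(c s, t) \<in> S" using cJ[OF that] t fc by (simp add: mem_S)
      then show ?thesis by (rule trans[OF D_expand[OF dif(1), symmetric] Neumann[OF cJ[OF that] t]])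
    qed
    have "((\<lambda>s. 0) has_real_derivative
        (\<Sum>i\<in>Basis. (M \<bullet> i) * D i U (x, t) + D p (D i U) (x, t) * (N x \<bullet> i))) (at 0)"
      by (rule has_field_derivative_transform_within_open[OF der J zero])
    then have "(\<Sum>i\<in>Basis. (M \<bullet> i) * D i U (x, t) + D p (D i U) (x, t) * (N x \<bullet> i)) = 0"
      using DERIV_const DERIV_unique by blast
    then have "M \<bullet> p + (\<Sum>i\<in>Basis. (N x \<bullet> i) * D p (D i U) (x, t)) = 0"
      by (simp add: sum.distrib euclidean_inner[of M p] pi mult.commute)
    moreover have "M \<bullet> p \<ge> 0"
    proof (rule monotone_derivative_inner_nonneg[OF Nc c])
      \<comment> \<open>Sum of the supporting half-space inequalities at \<open>c s\<close> and at
        \<open>x\<close>, each tested with the other point.\<close>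
      have "(N (c s) - N x) \<bullet> (c s - x) \<ge> 0" if "s \<in> J" for s
      proof -
        have "N (c s) \<bullet> (x - c s) \<le> 0" using supp[OF cJ[OF that] fc[OF x]] .
        moreover have "N x \<bullet> (c s - x) \<le> 0" using supp[OF x xr fc[OF cJ(1)[OF that]]] .
        ultimately show ?thesis by (simp add: inner_diff_left inner_diff_right)
      qed
      then show "\<forall>\<^sub>F s in at 0. 0 \<le> (N (c s) - N (c 0)) \<bullet> (c s - c 0)"
        using J c0 by (metis (mono_tags, lifting) eventually_at_topological)
    qed
    \<comment> \<open>Symmetry of the spatial Hessian exchanges the directions \<open>p\<close> and
      \<open>N x\<close>.\<close>
    moreover have "(\<Sum>i\<in>Basis. D i U (x, t) * D (N x) (D i U) (x, t))
        = (\<Sum>i\<in>Basis. (N x \<bullet> i) * D p (D i U) (x, t))"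
    proof -
      have "(\<Sum>i\<in>Basis. D i U (x, t) * D (N x) (D i U) (x, t))
          = (\<Sum>i\<in>Basis. \<Sum>j\<in>Basis. D i U (x, t) * ((N x \<bullet> j) * D j (D i U) (x, t)))"
        using xt[OF t] dif(2) by (simp add: D_expand[of "D _ U" _ "N x"] sum_distrib_left)
      also have "\<dots> = (\<Sum>j\<in>Basis. \<Sum>i\<in>Basis. D i U (x, t) * ((N x \<bullet> j) * D j (D i U) (x, t)))"
        by (rule sum.swap)
      also have "\<dots> = (\<Sum>j\<in>Basis. \<Sum>i\<in>Basis. (N x \<bullet> j) * ((p \<bullet> i) * D i (D j U) (x, t)))"
        by (intro sum.cong refl) (simp add: pi D_commute(1)[OF smooth_U xt[OF t]])
      also have "\<dots> = (\<Sum>j\<in>Basis. (N x \<bullet> j) * D p (D j U) (x, t))"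
        using xt[OF t] dif(2) by (simp add: D_expand[of "D _ U" _ p] sum_distrib_left)
      finally show ?thesis .
    qed
    ultimately show "(\<Sum>i\<in>Basis. D i U (x, t) * D (N x) (D i U) (x, t)) \<le> 0" by linarith
  qed
qed

end

section \<open>Evolution of the Hamilton quantity\<close>

text \<open>The first derivative vanishes at the maximum; a positive \<open>c\<close> would make it
  positive just to the right of 0, and the mean value theorem would give a larger value
  there.\<close>

lemma second_derivative_le_0_at_max:
  fixes \<phi> :: "real \<Rightarrow> real"
  assumes 1: "\<forall>\<^sub>F r in nhds 0. (\<phi> has_real_derivative \<phi>' r) (at r)"
    and 2: "(\<phi>' has_real_derivative c) (at 0)"
    and max: "\<forall>\<^sub>F r in nhds 0. \<phi> r \<le> \<phi> 0"
  shows "c \<le> 0"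
proof (rule ccontr)
  assume "\<not> c \<le> 0"
  from eventually_conj[OF 1 max] obtain d where d: "d > 0"
    and d1: "\<And>r. \<bar>r\<bar> < d \<Longrightarrow> (\<phi> has_real_derivative \<phi>' r) (at r)"
    and d2: "\<And>r. \<bar>r\<bar> < d \<Longrightarrow> \<phi> r \<le> \<phi> 0"
    by (auto simp: eventually_nhds_metric)
  have "\<phi>' 0 = 0"
    by (rule DERIV_local_max[OF d1 d(1)]) (use d d2 in auto)
  then obtain e where e: "e > 0" "\<And>h. 0 < h \<Longrightarrow> h < e \<Longrightarrow> \<phi>' h > 0"
    using DERIV_pos_inc_right[OF 2] \<open>\<not> c \<le> 0\<close> by auto
  define h where "h = min d e / 2"
  have h: "0 < h" "h < d" "h < e" using d e by (auto simp: h_def)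
  obtain \<xi> where \<xi>: "0 < \<xi>" "\<xi> < h" "\<phi> h - \<phi> 0 = (h - 0) * \<phi>' \<xi>"
    using MVT2[OF h(1), of \<phi> \<phi>'] d1 h(2) by auto
  moreover have "h * \<phi>' \<xi> > 0" using e(2)[of \<xi>] \<xi> h by (intro mult_pos_pos) auto
  ultimately have "\<phi> h > \<phi> 0" by simp
  then show False using d2[of h] h by simp
qed

text \<open>\<open>p\<close>, \<open>G\<close>, \<open>a\<close> stand for \<open>\<partial>\<^sub>t u\<close>, \<open>\<bar>D u\<bar>\<^sup>2\<close>, \<open>u + \<epsilon>\<close> along a line.\<close>

lemma profile_derivative:
  fixes p G a :: "real \<Rightarrow> real"
  assumes "(p has_real_derivative p') (at r within I)" "(G has_real_derivative G') (at r within I)"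
    "(a has_real_derivative a') (at r within I)" "a r > 0"
  shows "((\<lambda>r. \<theta> * (p r + G r / a r) - a r * (C - 7/2 * ln (a r))) has_real_derivative
     \<theta> * (p' + G' / a r - G r * a' / (a r)\<^sup>2) - (C - 7/2 * ln (a r) - 7/2) * a') (at r within I)"
  by (rule derivative_eq_intros assms refl | (use assms(4) in simp; fail))+
    (use assms(4) in \<open>simp add: field_simps power2_eq_square\<close>)

text \<open>In the time direction the factor \<open>t - s\<close> moves as well, hence
  \<open>\<theta> + r\<close>; this contributes the extra \<open>p 0 + G 0 / a 0\<close>.\<close>

lemma profile_time_derivative:
  fixes p G a :: "real \<Rightarrow> real"
  assumes "(p has_real_derivative p') (at 0)" "(G has_real_derivative G') (at 0)"
    "(a has_real_derivative a') (at 0)" "a 0 > 0"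
  shows "((\<lambda>r. (\<theta> + r) * (p r + G r / a r) - a r * (C - 7/2 * ln (a r))) has_real_derivative
     p 0 + G 0 / a 0 + \<theta> * (p' + G' / a 0 - G 0 * a' / (a 0)\<^sup>2)
       - (C - 7/2 * ln (a 0) - 7/2) * a') (at 0)"
  by (rule derivative_eq_intros assms refl | (use assms(4) in simp; fail))+
    (use assms(4) in \<open>simp add: field_simps power2_eq_square\<close>)

text \<open>The last summand comes from the logarithm; summed over the coordinate directions it
  becomes 7/2 |D u|^2 / (u + \<epsilon>).\<close>

lemma profile_second_derivative:
  fixes p' G G' a a' :: "real \<Rightarrow> real"
  assumes "(p' has_real_derivative p'') (at r)" "(G' has_real_derivative G'') (at r)"
    "(G has_real_derivative G' r) (at r)"
    "(a' has_real_derivative a'') (at r)" "(a has_real_derivative a' r) (at r)" "a r > 0"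
  shows "((\<lambda>r. \<theta> * (p' r + G' r / a r - G r * a' r / (a r)\<^sup>2) - (C - 7/2 * ln (a r) - 7/2) * a' r)
     has_real_derivative
     \<theta> * (p'' + G'' / a r - 2 * G' r * a' r / (a r)\<^sup>2 - G r * a'' / (a r)\<^sup>2 + 2 * G r * (a' r)\<^sup>2 / (a r)^3)
      - (C - 7/2 * ln (a r) - 7/2) * a'' + 7/2 * (a' r)\<^sup>2 / a r) (at r)"
  by (rule derivative_eq_intros assms refl | (use assms(6) in simp; fail))+
    (use assms(6) in \<open>simp add: field_simps power2_eq_square power3_eq_cube\<close>)

text \<open>The right side is the squared norm of the matrix \<open>h\<close> minus the rank-one
  matrix \<open>q i * q k / a\<close>. Dropping the off-diagonal entries and applying Cauchy-Schwarz
  to the diagonal bounds it below by the squared trace over the dimension.\<close>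

lemma square_sum_tensor:
  fixes q :: "'a::euclidean_space \<Rightarrow> real" and h :: "'a \<Rightarrow> 'a \<Rightarrow> real"
  assumes a: "a \<noteq> 0"
  defines "G \<equiv> \<Sum>k\<in>Basis. (q k)\<^sup>2"
  shows "((\<Sum>i\<in>Basis. h i i) - G / a)\<^sup>2 / DIM('a)
    \<le> (\<Sum>i\<in>Basis. \<Sum>k\<in>Basis. (h i k)\<^sup>2) - 2 * (\<Sum>i\<in>Basis. \<Sum>k\<in>Basis. q i * q k * h i k) / a + G\<^sup>2 / a\<^sup>2"
proof -
  define m where "m i k = h i k - q i * q k / a" for i k
  have "(\<Sum>i\<in>Basis. h i i) - G / a = (\<Sum>i\<in>Basis. m i i)"
    by (simp add: m_def G_def sum_subtractf sum_divide_distrib power2_eq_square)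
  then have "((\<Sum>i\<in>Basis. h i i) - G / a)\<^sup>2 \<le> (\<Sum>i\<in>Basis. (m i i)\<^sup>2) * DIM('a)"
    using sum_squared_le_sum_of_squares[of "\<lambda>i. m i i" "Basis :: 'a set"] by simp
  also have "\<dots> \<le> (\<Sum>i\<in>Basis. \<Sum>k\<in>Basis. (m i k)\<^sup>2) * DIM('a)"
    by (intro mult_right_mono sum_mono member_le_sum[of _ _ "\<lambda>k. (m _ k)\<^sup>2"]) auto
  finally have "((\<Sum>i\<in>Basis. h i i) - G / a)\<^sup>2 / DIM('a) \<le> (\<Sum>i\<in>Basis. \<Sum>k\<in>Basis. (m i k)\<^sup>2)"
    by (simp add: divide_le_eq)
  also have "(m i k)\<^sup>2 = (h i k)\<^sup>2 - 2 / a * (q i * q k * h i k) + (q i)\<^sup>2 * (q k)\<^sup>2 / a\<^sup>2" for i k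
    using a by (simp add: m_def field_simps power2_eq_square)
  then have "(\<Sum>i\<in>Basis. \<Sum>k\<in>Basis. (m i k)\<^sup>2) =
      (\<Sum>i\<in>Basis. \<Sum>k\<in>Basis. (h i k)\<^sup>2) - 2 / a * (\<Sum>i\<in>Basis. \<Sum>k\<in>Basis. q i * q k * h i k)
       + (\<Sum>i\<in>Basis. \<Sum>k\<in>Basis. (q i)\<^sup>2 * (q k)\<^sup>2) / a\<^sup>2"
    by (simp add: sum.distrib sum_subtractf sum_distrib_left sum_divide_distrib)
  also have "(\<Sum>i\<in>Basis. \<Sum>k\<in>Basis. (q i)\<^sup>2 * (q k)\<^sup>2) = G\<^sup>2"
    by (simp add: G_def power2_eq_square sum_product)
  finally show ?thesis by simp
qed

text \<open>Where the constant \<open>7/2\<close> is used: the quadratic form \<open>- Z\<^sup>2 + Z Y / 2 - 3 Y\<^sup>2\<close> with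
  \<open>Z = X - Y\<close> is negative definite. Keeping the decay quadratic in \<open>W\<close> allows a comparison
  with barriers that blow up at a finite distance.\<close>

lemma reaction_term_decay:
  fixes X Y L n A T :: real
  assumes \<theta>: "0 < \<theta>" "\<theta> \<le> T" and a: "0 < a" "a \<le> A" and n: "n \<ge> 1"
    and Y: "0 \<le> Y" "Y \<le> M" and M: "M > 0" and L: "L \<ge> 0"
    and W: "W = \<theta> * (X + Y) - a * (n + 7/2 * L)" "W > 0"
  shows "X - 5/2 * Y - 2 * \<theta> / (n * a) * (X - Y)\<^sup>2
    \<le> - min (1 / (4 * T * n * A)) (1 / (500 * M * T\<^sup>2)) * W\<^sup>2"
proof -
  define q where "q = \<theta> / (n * a)"
  define Z where "Z = X - Y"
  define s where "s = Z + 2 * Y"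
  have q: "q > 0" using \<theta> n a by (simp add: q_def)
  have na: "n * a > 0" using n a by simp
  have Ws: "W \<le> \<theta> * s" "W \<le> \<theta> * s - a * n"
  proof -
    have "a * (n + 7/2 * L) \<ge> a * n" "a * n > 0" using a L n by auto
    moreover have "X + Y = s" by (simp add: s_def Z_def)
    ultimately show "W \<le> \<theta> * s" "W \<le> \<theta> * s - a * n" using W by auto
  qed
  have s: "s > 0"
  proof -
    have "\<theta> * s > 0" using Ws W by simp
    then show ?thesis using \<theta> by (simp add: zero_less_mult_iff)
  qed
  \<comment> \<open>Positivity of \<open>W\<close> beats the summand \<open>a * n\<close>, so the
    coefficient \<open>q\<close> of the good square exceeds \<open>1 / s\<close>.\<close>
  have qs: "q * s > 1"
  proof -
    have "\<theta> * s > n * a" using Ws W by (simp add: mult.commute)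
    then show ?thesis using na by (simp add: q_def less_divide_eq)
  qed
  have W2: "W\<^sup>2 \<le> \<theta>\<^sup>2 * s\<^sup>2"
    using power_mono[OF Ws(1), of 2] W by (simp add: power_mult_distrib)
  have eq: "X - 5/2 * Y - 2 * \<theta> / (n * a) * (X - Y)\<^sup>2 = Z - 3/2 * Y - 2 * q * Z\<^sup>2"
    by (simp add: Z_def q_def)
  show ?thesis
  proof (cases "10 * Y < s")
    case True
    \<comment> \<open>Small \<open>Y\<close>: \<open>Z\<close> is most of \<open>s\<close>, so the
      square term is at least 32/25 of \<open>q * s^2\<close>, while \<open>Z\<close> is at most
      \<open>s\<close>, hence at most \<open>q * s^2\<close>. The surplus 7/25 covers the 1/4 that
      is kept.\<close>
    have "Z \<ge> 4/5 * s" using True by (simp add: s_def)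
    then have "Z\<^sup>2 \<ge> (4/5 * s)\<^sup>2" using s by (intro power_mono) auto
    then have "2 * q * (4/5 * s)\<^sup>2 \<le> 2 * q * Z\<^sup>2" using q by simp
    moreover have "s \<le> q * s\<^sup>2" using mult_right_mono[of 1 "q * s" s] qs s by (simp add: power2_eq_square)
    moreover have "2 * q * (4/5 * s)\<^sup>2 = 32/25 * (q * s\<^sup>2)" by (simp add: power_mult_distrib power_divide)
    moreover have "Z \<le> s" using Y by (simp add: s_def)
    ultimately have "Z - 3/2 * Y - 2 * q * Z\<^sup>2 \<le> - (1/4) * (q * s\<^sup>2)"
      using Y q s by linarith
    also have "\<dots> \<le> - (1 / (4 * T * n * A)) * W\<^sup>2"
    proof -
      have "W\<^sup>2 / (T * n * A) \<le> \<theta>\<^sup>2 * s\<^sup>2 / (\<theta> * n * a)"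
        using W2 \<theta> n a by (intro frac_le mult_mono) auto
      also have "\<dots> = q * s\<^sup>2" using \<theta> by (simp add: q_def power2_eq_square)
      finally show ?thesis by simp
    qed
    also have "\<dots> \<le> - min (1 / (4 * T * n * A)) (1 / (500 * M * T\<^sup>2)) * W\<^sup>2"
      by (intro mult_right_mono le_imp_neg_le min.cobounded1 zero_le_power2)
    finally show ?thesis using eq by simp
  next
    case False
    \<comment> \<open>Here \<open>Y\<close> is at least a tenth of \<open>s\<close>. Replacing
      \<open>q\<close> by \<open>1 / s\<close> and multiplying by \<open>s\<close> produces the
      quadratic form in \<open>Z\<close> and \<open>Y\<close>.\<close>
    have Z2: "Z\<^sup>2 / s \<le> q * Z\<^sup>2"
      using qs s mult_right_mono[of 1 "q * s" "Z\<^sup>2"] by (simp add: divide_le_eq mult_ac)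
    have "s * (Z - 3/2 * Y - 2 * (Z\<^sup>2 / s)) = - (Z\<^sup>2) + Z * Y / 2 - 3 * Y\<^sup>2"
      using s by (simp add: s_def field_simps power2_eq_square)
    also have "\<dots> \<le> - 2 * Y\<^sup>2"
    proof -
      have "0 \<le> (Z - Y / 4)\<^sup>2" by simp
      also have "\<dots> = Z\<^sup>2 - Z * Y / 2 + Y\<^sup>2 / 16" by (simp add: power2_eq_square algebra_simps)
      finally show ?thesis using zero_le_power2[of Y] by linarith
    qed
    also have "\<dots> \<le> s * (- s / 50)"
    proof -
      have "s\<^sup>2 \<le> (10 * Y)\<^sup>2" using False s by (intro power_mono) auto
      then show ?thesis by (simp add: power2_eq_square)
    qed
    finally have "Z - 3/2 * Y - 2 * (Z\<^sup>2 / s) \<le> - s / 50" using s by (simp only: mult_le_cancel_left_pos)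
    then have "Z - 3/2 * Y - 2 * q * Z\<^sup>2 \<le> - s / 50" using Z2 by simp
    also have "\<dots> \<le> - (1 / (500 * M * T\<^sup>2)) * W\<^sup>2"
    proof -
      \<comment> \<open>\<open>s\<close> is at most \<open>10 * M\<close>: the bound on
        \<open>Y\<close> turns decay linear in \<open>s\<close> into decay quadratic in
        \<open>W\<close>. The 500 is 50 times 10.\<close>
      have "s\<^sup>2 \<le> 10 * M * s" using False Y s by (simp add: power2_eq_square)
      moreover have "\<theta>\<^sup>2 * s\<^sup>2 \<le> T\<^sup>2 * s\<^sup>2" using \<theta> by (intro mult_right_mono power_mono) auto
      ultimately have "W\<^sup>2 \<le> T\<^sup>2 * (10 * M * s)"
        using W2 by (meson mult_left_mono order_trans zero_le_power2)
      then show ?thesis using M \<theta> by (simp add: field_simps)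
    qed
    also have "\<dots> \<le> - min (1 / (4 * T * n * A)) (1 / (500 * M * T\<^sup>2)) * W\<^sup>2"
      by (intro mult_right_mono le_imp_neg_le min.cobounded2 zero_le_power2)
    finally show ?thesis using eq by simp
  qed
qed

section \<open>The heat operator applied to \<open>W\<close>\<close>

context neumann_heat
begin

definition G :: "'a \<times> real \<Rightarrow> real" where "G z = (\<Sum>k\<in>Basis. (D k U z)\<^sup>2)"

text \<open>The function of the overview when \<open>C\<close> is the dimension plus
  \<open>7/2 * ln (A + \<epsilon>)\<close>. \<open>C\<close> stays free because multiples of
  \<open>U z + \<epsilon>\<close> solve the heat equation and do not affect the evolution.\<close>

definition W :: "real \<Rightarrow> real \<Rightarrow> real \<Rightarrow> 'a \<times> real \<Rightarrow> real" where
  "W s \<epsilon> C z = (snd z - s) * (Dt U z + G z / (U z + \<epsilon>)) - (U z + \<epsilon>) * (C - 7/2 * ln (U z + \<epsilon>))"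

lemma line_derivative:
  assumes "smooth_on S f" "z + r *\<^sub>R v \<in> interior S"
  shows "((\<lambda>r. f (z + r *\<^sub>R v)) has_real_derivative pd S v f (z + r *\<^sub>R v)) (at r)"
  by (rule has_derivative_along_line_at[OF has_derivative_pd_interior])
    (use assms smooth_on_imp in auto)

text \<open>The equation has constant coefficients, so derivatives of solutions are solutions.
  \<open>v\<close> is a space-time basis vector, which covers both the time derivative and the
  components of the gradient.\<close>

lemma laplacian_pd:
  assumes v: "v \<in> Basis" and z: "z \<in> S"
  shows "(\<Sum>i\<in>Basis. D i (D i (pd S v U)) z) = pd S v (Dt U) z"
proof -
  have "D i (D i (pd S v U)) z = pd S v (D i (D i U)) z" if i: "i \<in> Basis" for i
  proof -
    have "D i (D i (pd S v U)) z = D i (pd S v (D i U)) z"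
      by (rule pd_cong[OF _ z]) (rule pd_commute[OF smooth_U Basis_prod(1)[OF i] v])
    also have "\<dots> = pd S v (D i (D i U)) z"
      by (rule pd_commute[OF smooth_D[OF smooth_U i] Basis_prod(1)[OF i] v z])
    finally show ?thesis .
  qed
  then have "(\<Sum>i\<in>Basis. D i (D i (pd S v U)) z) = (\<Sum>i\<in>Basis. pd S v (D i (D i U)) z)" by simp
  also have "\<dots> = pd S v (\<lambda>z. \<Sum>i\<in>Basis. D i (D i U) z) z"
    using smooth_U z by (intro pd_sum[symmetric] smooth_on_imp(2)) auto
  also have "\<dots> = pd S v (Dt U) z"
    by (rule pd_cong[OF _ z]) (simp add: heat_equation)
  finally show ?thesis .
qed

text \<open>With a = u + \<epsilon>, the heat operator annihilates the time derivative of u and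
  sends |D u|^2 / a to -2/a times the squared norm of the Hessian minus the tensor square of D u
  divided by a; \<open>square_sum_tensor\<close> bounds that norm. The result is phrased through
  one-variable derivatives along coordinate lines, the form in which it is tested at a
  maximum.\<close>

lemma evolution:
  fixes s \<epsilon> C :: real
  assumes z: "z \<in> interior S" and pos: "\<And>y. y \<in> interior S \<Longrightarrow> U y + \<epsilon> > 0"
  defines "X \<equiv> Dt U z" and "Y \<equiv> G z / (U z + \<epsilon>)" and "\<theta> \<equiv> snd z - s"
  assumes \<theta>: "\<theta> \<ge> 0"
  obtains w H where
    "((\<lambda>r. W s \<epsilon> C (z + r *\<^sub>R (0, 1))) has_real_derivative w) (at 0)"
    "\<And>i. i \<in> Basis \<Longrightarrow> \<exists>w'. (\<forall>\<^sub>F r in nhds 0.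
        ((\<lambda>r. W s \<epsilon> C (z + r *\<^sub>R (i, 0))) has_real_derivative w' r) (at r)) \<and>
        (w' has_real_derivative H i) (at 0)"
    "w - (\<Sum>i\<in>Basis. H i) \<le> X - 5/2 * Y - 2 * \<theta> / (DIM('a) * (U z + \<epsilon>)) * (X - Y)\<^sup>2"
proof -
  note sm = smooth_U smooth_D[OF smooth_U] smooth_Dt[OF smooth_U]
  have zS: "z \<in> S" using z interior_subset by blast
  define a where "a = U z + \<epsilon>"
  have a: "a > 0" using pos[OF z] by (simp add: a_def)
  define q where "q k = D k U z" for k
  define h where "h i k = D i (D k U) z" for i k
  define g where "g = C - 7/2 * ln a - 7/2"
  define Gv where "Gv v y = (\<Sum>k\<in>Basis. 2 * D k U y * pd S v (D k U) y)" for v y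
  define Gvv where "Gvv i = (\<Sum>k\<in>Basis. 2 * (h i k)\<^sup>2 + 2 * q k * D i (D i (D k U)) z)" for i
  have G_line: "((\<lambda>r. G (z + r *\<^sub>R v)) has_real_derivative Gv v (z + r *\<^sub>R v)) (at r)"
    if "z + r *\<^sub>R v \<in> interior S" for r v
    unfolding G_def[abs_def] Gv_def using line_derivative[OF sm(2) that]
    by (auto intro!: DERIV_sum derivative_eq_intros simp: power2_eq_square)
  have U_line: "((\<lambda>r. U (z + r *\<^sub>R v) + \<epsilon>) has_real_derivative pd S v U (z + r *\<^sub>R v)) (at r)"
    if "z + r *\<^sub>R v \<in> interior S" for r v
    using line_derivative[OF sm(1) that] by (auto intro!: derivative_eq_intros)
  define w where "w = X + Y + \<theta> * (Dt (Dt U) z + Gv (0, 1) z / a - G z * X / a\<^sup>2) - g * X"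
  define H where "H i = \<theta> * (D i (D i (Dt U)) z + Gvv i / a - 2 * Gv (i, 0) z * q i / a\<^sup>2
      - G z * h i i / a\<^sup>2 + 2 * G z * (q i)\<^sup>2 / a^3) - g * h i i + 7/2 * (q i)\<^sup>2 / a" for i
  show ?thesis
  proof (rule that)
    have snd_eq: "snd (z + r *\<^sub>R (0, 1)) - s = \<theta> + r" for r by (simp add: \<theta>_def)
    show "((\<lambda>r. W s \<epsilon> C (z + r *\<^sub>R (0, 1))) has_real_derivative w) (at 0)"
      using profile_time_derivative[OF line_derivative[OF sm(3), of z 0 "(0, 1)"] G_line[of 0 "(0, 1)"]
          U_line[of 0 "(0, 1)"] pos, of \<theta> C] z
      unfolding W_def snd_eq by (simp add: w_def X_def Y_def a_def g_def zero_prod_def[symmetric])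
  next
    fix i :: 'a assume i: "i \<in> Basis"
    let ?l = "\<lambda>r. z + r *\<^sub>R (i, 0)"
    define w' where "w' r = \<theta> * (D i (Dt U) (?l r) + Gv (i, 0) (?l r) / (U (?l r) + \<epsilon>)
        - G (?l r) * D i U (?l r) / (U (?l r) + \<epsilon>)\<^sup>2) - (C - 7/2 * ln (U (?l r) + \<epsilon>) - 7/2) * D i U (?l r)" for r
    have z0: "?l 0 \<in> interior S" using z by (simp add: zero_prod_def[symmetric])
    have 1: "((\<lambda>r. W s \<epsilon> C (?l r)) has_real_derivative w' r) (at r)" if r: "?l r \<in> interior S" for r
      using profile_derivative[OF line_derivative[OF sm(3) r] G_line[OF r] U_line[OF r] pos[OF r], of \<theta> C]
      unfolding w'_def W_def \<theta>_def by simp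
    have "\<forall>\<^sub>F r in nhds 0. ?l r \<in> interior S"
    proof -
      have "open (?l -` interior S)" by (intro open_vimage open_interior continuous_intros)
      then show ?thesis
        using z by (auto simp: eventually_nhds zero_prod_def[symmetric] intro!: exI[of _ "?l -` interior S"])
    qed
    then have "\<forall>\<^sub>F r in nhds 0. ((\<lambda>r. W s \<epsilon> C (?l r)) has_real_derivative w' r) (at r)"
      by eventually_elim (rule 1)
    moreover have Gv_line: "((\<lambda>r. Gv (i, 0) (?l r)) has_real_derivative Gvv i) (at 0)"
      unfolding Gv_def Gvv_def h_def q_def
    proof (rule DERIV_sum)
      fix k :: 'a assume k: "k \<in> Basis"
      show "((\<lambda>r. 2 * D k U (?l r) * D i (D k U) (?l r)) has_real_derivative
          2 * (D i (D k U) z)\<^sup>2 + 2 * D k U z * D i (D i (D k U)) z) (at 0)"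
        using line_derivative[OF sm(2)[OF k] z0] line_derivative[OF smooth_D[OF sm(2)[OF k] i] z0]
        by (auto intro!: derivative_eq_intros simp: power2_eq_square zero_prod_def[symmetric])
    qed
    have "(w' has_real_derivative H i) (at 0)"
      using profile_second_derivative[OF line_derivative[OF smooth_D[OF sm(3) i] z0] Gv_line G_line[OF z0]
          line_derivative[OF sm(2)[OF i] z0] U_line[OF z0] pos[OF z0], of \<theta> C]
      unfolding w'_def[abs_def] H_def by (simp add: a_def g_def q_def h_def zero_prod_def[symmetric])
    ultimately show "\<exists>w'. (\<forall>\<^sub>F r in nhds 0. ((\<lambda>r. W s \<epsilon> C (?l r)) has_real_derivative w' r) (at r)) \<and>
        (w' has_real_derivative H i) (at 0)" by blast
  next
    have Xh: "X = (\<Sum>i\<in>Basis. h i i)" by (simp add: X_def h_def heat_equation[OF zS])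
    have Gq: "G z = (\<Sum>k\<in>Basis. (q k)\<^sup>2)" by (simp add: G_def q_def)
    \<comment> \<open>A Bochner-type identity: the heat equation contracts the third derivatives to
      the time derivative of \<open>G\<close>, which cancels later; only the squared Hessian
      remains.\<close>
    have Gvv: "(\<Sum>i\<in>Basis. Gvv i) = 2 * (\<Sum>i\<in>Basis. \<Sum>k\<in>Basis. (h i k)\<^sup>2) + Gv (0, 1) z"
    proof -
      have "(\<Sum>i\<in>Basis. \<Sum>k\<in>Basis. 2 * q k * D i (D i (D k U)) z)
          = (\<Sum>k\<in>Basis. \<Sum>i\<in>Basis. 2 * q k * D i (D i (D k U)) z)" by (rule sum.swap)
      also have "\<dots> = (\<Sum>k\<in>Basis. 2 * q k * D k (Dt U) z)"
        by (intro sum.cong refl) (simp add: sum_distrib_left[symmetric] laplacian_pd[OF Basis_prod(1) zS])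
      also have "\<dots> = Gv (0, 1) z"
        unfolding Gv_def q_def by (intro sum.cong refl) (simp add: D_commute(2)[OF smooth_U zS])
      finally show ?thesis by (simp add: Gvv_def sum.distrib sum_distrib_left)
    qed
    have Gvq: "(\<Sum>i\<in>Basis. Gv (i, 0) z * q i) = 2 * (\<Sum>i\<in>Basis. \<Sum>k\<in>Basis. q i * q k * h i k)"
      unfolding Gv_def q_def h_def by (simp add: sum_distrib_left sum_distrib_right mult_ac)
    have tt: "(\<Sum>i\<in>Basis. D i (D i (Dt U)) z) = Dt (Dt U) z" by (rule laplacian_pd[OF Basis_prod(2) zS])
    have "(\<Sum>i\<in>Basis. H i) = \<theta> * ((\<Sum>i\<in>Basis. D i (D i (Dt U)) z) + (\<Sum>i\<in>Basis. Gvv i) / a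
        - 2 * (\<Sum>i\<in>Basis. Gv (i, 0) z * q i) / a\<^sup>2 - G z * (\<Sum>i\<in>Basis. h i i) / a\<^sup>2
        + 2 * G z * (\<Sum>i\<in>Basis. (q i)\<^sup>2) / a^3) - g * (\<Sum>i\<in>Basis. h i i) + 7/2 * (\<Sum>i\<in>Basis. (q i)\<^sup>2) / a"
      unfolding H_def
      by (simp add: sum.distrib sum_subtractf sum_distrib_left sum_divide_distrib distrib_left
          right_diff_distrib mult.assoc)
    then have sumH: "(\<Sum>i\<in>Basis. H i) = \<theta> * (Dt (Dt U) z
        + (2 * (\<Sum>i\<in>Basis. \<Sum>k\<in>Basis. (h i k)\<^sup>2) + Gv (0, 1) z) / a
        - 2 * (2 * (\<Sum>i\<in>Basis. \<Sum>k\<in>Basis. q i * q k * h i k)) / a\<^sup>2 - G z * X / a\<^sup>2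
        + 2 * G z * G z / a^3) - g * X + 7/2 * G z / a"
      unfolding tt Gvv Gvq Xh[symmetric] Gq[symmetric] .
    define K where "K = (\<Sum>i\<in>Basis. \<Sum>k\<in>Basis. (h i k)\<^sup>2)
        - 2 * (\<Sum>i\<in>Basis. \<Sum>k\<in>Basis. q i * q k * h i k) / a + (G z)\<^sup>2 / a\<^sup>2"
    have Ya: "Y = G z / a" by (simp add: Y_def a_def)
    \<comment> \<open>The terms with \<open>g\<close>, with \<open>Dt (Dt U)\<close> and with
      \<open>G z * X\<close> cancel. What survives is \<open>X + Y\<close> from the factor
      \<open>t - s\<close>, minus \<open>7/2 * Y\<close> from the logarithm, and
      \<open>K\<close>.\<close>
    have "w - (\<Sum>i\<in>Basis. H i) = X - 5/2 * Y - 2 * \<theta> / a * K"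
      unfolding w_def sumH K_def Ya using a by (simp add: field_simps power2_eq_square power3_eq_cube)
    moreover have "(X - Y)\<^sup>2 / DIM('a) \<le> K"
      using square_sum_tensor[of a h q] a unfolding K_def Ya Xh Gq by simp
    then have "2 * \<theta> / a * ((X - Y)\<^sup>2 / DIM('a)) \<le> 2 * \<theta> / a * K"
      using \<theta> a by (intro mult_left_mono) auto
    ultimately show "w - (\<Sum>i\<in>Basis. H i)
        \<le> X - 5/2 * Y - 2 * \<theta> / (DIM('a) * (U z + \<epsilon>)) * (X - Y)\<^sup>2"
      by (simp add: a_def mult.commute)
  qed
qed

end

section \<open>Comparison with barriers\<close>

text \<open>\<open>\<sigma>\<close> is meant to be the squared distance to the centre along a line,
  so that the inward normal at the boundary and the coordinate directions inside are treated
  alike.\<close>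

lemma barrier_derivative:
  fixes \<sigma> :: "real \<Rightarrow> real"
  assumes "(\<sigma> has_real_derivative \<sigma>') (at r within I)" "K - \<sigma> r > 0"
  shows "((\<lambda>r. M / (K - \<sigma> r)\<^sup>2) has_real_derivative 2 * M * \<sigma>' / (K - \<sigma> r)^3) (at r within I)"
proof -
  define d where "d r = K - \<sigma> r" for r
  have "(d has_real_derivative - \<sigma>') (at r within I)"
    unfolding d_def[abs_def] using assms(1) by (auto intro!: derivative_eq_intros)
  moreover have "d r > 0" using assms(2) by (simp add: d_def)
  ultimately have "((\<lambda>r. M / (d r)\<^sup>2) has_real_derivative 2 * M * \<sigma>' / (d r)^3) (at r within I)"
    by (auto intro!: derivative_eq_intros simp: field_simps power2_eq_square power3_eq_cube)
  then show ?thesis by (simp add: d_def)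
qed

lemma barrier_second_derivative:
  fixes \<sigma> \<sigma>' :: "real \<Rightarrow> real"
  assumes "(\<sigma> has_real_derivative \<sigma>' r) (at r)" "(\<sigma>' has_real_derivative \<sigma>'') (at r)" "K - \<sigma> r > 0"
  shows "((\<lambda>r. 2 * M * \<sigma>' r / (K - \<sigma> r)^3) has_real_derivative
    2 * M * \<sigma>'' / (K - \<sigma> r)^3 + 6 * M * (\<sigma>' r)\<^sup>2 / (K - \<sigma> r)^4) (at r)"
proof -
  define d where "d r = K - \<sigma> r" for r
  have "(d has_real_derivative - \<sigma>' r) (at r)"
    unfolding d_def[abs_def] using assms(1) by (auto intro!: derivative_eq_intros)
  moreover have "d r > 0" using assms(3) by (simp add: d_def)
  ultimately have "((\<lambda>r. 2 * M * \<sigma>' r / (d r)^3) has_real_derivative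
      2 * M * \<sigma>'' / (d r)^3 + 6 * M * (\<sigma>' r)\<^sup>2 / (d r)^4) (at r)"
    using assms(2)
    by (auto intro!: derivative_eq_intros
        simp: field_simps power2_eq_square power3_eq_cube power4_eq_xxxx)
  then show ?thesis by (simp add: d_def)
qed

lemma norm_power2_line_derivative:
  fixes y v :: "'a::euclidean_space"
  shows "((\<lambda>r. (norm (y + r *\<^sub>R v))\<^sup>2) has_real_derivative 2 * ((y + r *\<^sub>R v) \<bullet> v)) (at r within I)"
proof -
  have "(norm (y + r *\<^sub>R v))\<^sup>2 = y \<bullet> y + 2 * r * (y \<bullet> v) + r\<^sup>2 * (v \<bullet> v)" for r
    unfolding power2_norm_eq_inner
    by (simp add: inner_add_left inner_add_right inner_commute power2_eq_square algebra_simps)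
  then show ?thesis
    by (auto intro!: derivative_eq_intros simp: inner_add_left)
qed

context neumann_heat
begin

text \<open>\<open>U\<close> and \<open>Dt U\<close> have vanishing normal derivative, so only
  \<open>G\<close> contributes to the slope of \<open>W\<close> along \<open>-N\<close>, with the
  sign that convexity dictates in \<open>boundary_normal\<close>.\<close>

lemma W_boundary_increasing:
  assumes x: "x \<in> frontier \<Omega>" and t: "t \<in> {0<..<T}" "s \<le> t"
    and pos: "\<And>y. y \<in> S \<Longrightarrow> U y + \<epsilon> > 0" and x0: "x0 \<in> \<Omega>"
  obtains N \<delta> w where "N \<noteq> 0" "\<delta> > 0" "\<And>r. r \<in> {0..<\<delta>} \<Longrightarrow> x - r *\<^sub>R N \<in> closure \<Omega>"
    "(x - x0) \<bullet> N > 0" "w \<ge> 0"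
    "((\<lambda>r. W s \<epsilon> C (x - r *\<^sub>R N, t)) has_real_derivative w) (at 0 within {0..<\<delta>})"
proof -
  obtain N where N: "N \<noteq> 0" "\<And>z. z \<in> closure \<Omega> \<Longrightarrow> N \<bullet> (z - x) \<le> 0"
    "\<exists>\<delta>>0. \<forall>\<theta>. 0 < \<theta> \<and> \<theta> < \<delta> \<longrightarrow> x - \<theta> *\<^sub>R N \<in> \<Omega>"
    "D N U (x, t) = 0" "D N (Dt U) (x, t) = 0"
    "(\<Sum>i\<in>Basis. D i U (x, t) * D N (D i U) (x, t)) \<le> 0"
    by (rule boundary_normal[OF x]) (use t(1) in blast)
  obtain \<delta> where \<delta>: "\<delta> > 0" "\<And>r. 0 < r \<Longrightarrow> r < \<delta> \<Longrightarrow> x - r *\<^sub>R N \<in> \<Omega>" using N(3) by blast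
  have cl: "x - r *\<^sub>R N \<in> closure \<Omega>" if "r \<in> {0..<\<delta>}" for r
  proof (cases "r = 0")
    case True
    then show ?thesis using x by (simp add: frontier_def)
  next
    case False
    then show ?thesis using \<delta>(2)[of r] that closure_subset[of \<Omega>] by auto
  qed
  have xS: "(x, t) \<in> S" using cl[of 0] \<delta> t by (simp add: mem_S)
  have inS: "(x, t) + r *\<^sub>R (- N, 0) \<in> S" if "r \<in> {0..<\<delta>}" for r
    using cl[OF that] t by (simp add: mem_S)
  have neg: "pd S (- N, 0) f (x, t) = - D N f (x, t)" if "smooth_on S f" for f
    using linear_neg[OF pd_linear[OF smooth_on_imp(2)[OF that] xS], of "(N, 0)"] by simp
  have line: "((\<lambda>r. f (x - r *\<^sub>R N, t)) has_real_derivative - D N f (x, t)) (at 0 within {0..<\<delta>})"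
    if "smooth_on S f" for f
  proof -
    have "((\<lambda>r. f ((x, t) + r *\<^sub>R (- N, 0))) has_real_derivative pd S (- N, 0) f (x, t)) (at 0 within {0..<\<delta>})"
      by (rule has_derivative_along_line[OF has_derivative_pd[OF smooth_on_imp(2)[OF that] xS]]) (rule inS)
    then show ?thesis using neg[OF that] by simp
  qed
  define G' where "G' = (\<Sum>k\<in>Basis. 2 * D k U (x, t) * - D N (D k U) (x, t))"
  have "G' = - 2 * (\<Sum>k\<in>Basis. D k U (x, t) * D N (D k U) (x, t))"
    by (simp add: G'_def sum_distrib_left sum_negf mult.assoc)
  then have G': "G' \<ge> 0" using N(6) by simp
  have "((\<lambda>r. G (x - r *\<^sub>R N, t)) has_real_derivative G') (at 0 within {0..<\<delta>})"
    unfolding G_def G'_def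
  proof (rule DERIV_sum)
    fix k :: 'a assume "k \<in> Basis"
    from DERIV_power[OF line[OF smooth_D[OF smooth_U this]], of 2]
    show "((\<lambda>r. (D k U (x - r *\<^sub>R N, t))\<^sup>2) has_real_derivative 2 * D k U (x, t) * - D N (D k U) (x, t))
        (at 0 within {0..<\<delta>})"
      by (simp add: mult_ac)
  qed
  moreover have "((\<lambda>r. U (x - r *\<^sub>R N, t) + \<epsilon>) has_real_derivative 0) (at 0 within {0..<\<delta>})"
    using line[OF smooth_U] N(4) by (auto intro!: derivative_eq_intros)
  moreover have "((\<lambda>r. Dt U (x - r *\<^sub>R N, t)) has_real_derivative 0) (at 0 within {0..<\<delta>})"
    using line[OF smooth_Dt[OF smooth_U]] N(5) by simp
  ultimately have "((\<lambda>r. W s \<epsilon> C (x - r *\<^sub>R N, t)) has_real_derivative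
      (t - s) * (G' / (U (x, t) + \<epsilon>))) (at 0 within {0..<\<delta>})"
    using profile_derivative[of "\<lambda>r. Dt U (x - r *\<^sub>R N, t)" 0 0 "{0..<\<delta>}" "\<lambda>r. G (x - r *\<^sub>R N, t)" G'
        "\<lambda>r. U (x - r *\<^sub>R N, t) + \<epsilon>" 0 "t - s" C] pos[OF xS]
    unfolding W_def by simp
  moreover have "(t - s) * (G' / (U (x, t) + \<epsilon>)) \<ge> 0"
    using t G' pos[OF xS] by simp
  \<comment> \<open>Strictness comes from openness: \<open>x0 + h *\<^sub>R N\<close> still lies in
    \<open>\<Omega>\<close>, and the supporting inequality is applied to that point.\<close>
  moreover have "(x - x0) \<bullet> N > 0"
  proof -
    obtain e where e: "e > 0" "ball x0 e \<subseteq> \<Omega>" using open_\<Omega> x0 openE by blast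
    define h where "h = e / (2 * norm N)"
    have h: "h > 0" using e N(1) by (simp add: h_def)
    have "x0 + h *\<^sub>R N \<in> ball x0 e" using e N(1) by (simp add: dist_norm h_def)
    then have "N \<bullet> (x0 + h *\<^sub>R N - x) \<le> 0" using e(2) closure_subset by (intro N(2)) blast
    moreover have "h * (N \<bullet> N) > 0" using h N(1) by simp
    ultimately show ?thesis by (simp add: inner_diff_left inner_diff_right inner_add_right inner_commute)
  qed
  ultimately show ?thesis using that N(1) \<delta>(1) cl by blast
qed

lemma continuous_on_W:
  assumes "\<And>y. y \<in> S \<Longrightarrow> U y + \<epsilon> > 0"
  shows "continuous_on S (W s \<epsilon> C)"
proof -
  have "continuous_on S U" "continuous_on S (Dt U)" "\<And>k. k \<in> Basis \<Longrightarrow> continuous_on S (D k U)"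
    using smooth_U smooth_on_imp(1) by blast+
  then show ?thesis
    unfolding W_def[abs_def] G_def[abs_def] using assms
    by (intro continuous_intros) (auto simp: less_imp_neq[symmetric])
qed

section \<open>Maximum principle on the interval from \<open>s\<close> to \<open>\<tau>\<close>, for
  fixed \<open>\<epsilon>\<close>\<close>

context
  fixes \<epsilon> A M s \<tau> \<kappa> :: real
  assumes \<epsilon>: "\<epsilon> > 0" and M: "M > 0" and s: "0 < s" "s < \<tau>" "\<tau> < T"
    and U_bounds: "\<And>y. y \<in> S \<Longrightarrow> 0 \<le> U y \<and> U y \<le> A"
    and G_bound: "\<And>y. y \<in> interior S \<Longrightarrow> G y / (U y + \<epsilon>) \<le> M"
    and \<kappa>_def: "\<kappa> = min (1 / (4 * T * DIM('a) * (A + \<epsilon>))) (1 / (500 * M * T\<^sup>2))"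
begin

abbreviation "WC \<equiv> W s \<epsilon> (DIM('a) + 7/2 * ln (A + \<epsilon>))"

lemma U_plus_eps_pos: "y \<in> S \<Longrightarrow> U y + \<epsilon> > 0"
  using U_bounds[of y] \<epsilon> by simp

lemma \<kappa>_pos: "\<kappa> > 0"
proof -
  obtain y where "y \<in> S" using interior_S interior_subset by blast
  then have "A + \<epsilon> > 0" using U_bounds[of y] \<epsilon> by simp
  then show ?thesis using M T by (simp add: \<kappa>_def)
qed

text \<open>The factor \<open>t - s\<close> vanishes, and \<open>U \<le> A\<close> makes the
  logarithmic part nonnegative.\<close>

lemma W_initial: "(x, s) \<in> S \<Longrightarrow> WC (x, s) \<le> 0"
proof -
  assume xs: "(x, s) \<in> S"
  have "ln (U (x, s) + \<epsilon>) \<le> ln (A + \<epsilon>)" using U_bounds[OF xs] U_plus_eps_pos[OF xs] by simp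
  then have "0 \<le> DIM('a) + 7/2 * ln (A + \<epsilon>) - 7/2 * ln (U (x, s) + \<epsilon>)" by (simp add: add_nonneg_nonneg)
  then have "0 \<le> (U (x, s) + \<epsilon>) * (DIM('a) + 7/2 * ln (A + \<epsilon>) - 7/2 * ln (U (x, s) + \<epsilon>))"
    using U_plus_eps_pos[OF xs] by simp
  then show ?thesis by (simp add: W_def)
qed

lemma W_decay:
  assumes z: "z \<in> interior S" "s < snd z" and W: "WC z > 0"
  obtains w H where
    "((\<lambda>r. WC (z + r *\<^sub>R (0, 1))) has_real_derivative w) (at 0)"
    "\<And>i. i \<in> Basis \<Longrightarrow> \<exists>w'. (\<forall>\<^sub>F r in nhds 0.
        ((\<lambda>r. WC (z + r *\<^sub>R (i, 0))) has_real_derivative w' r) (at r)) \<and>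
        (w' has_real_derivative H i) (at 0)"
    "w - (\<Sum>i\<in>Basis. H i) \<le> - \<kappa> * (WC z)\<^sup>2"
proof -
  have zS: "z \<in> S" using z interior_subset by blast
  have tT: "snd z < T" using zS by (cases z) (simp add: mem_S)
  have pos': "U y + \<epsilon> > 0" if "y \<in> interior S" for y using U_plus_eps_pos that interior_subset by blast
  define L where "L = ln (A + \<epsilon>) - ln (U z + \<epsilon>)"
  have L: "L \<ge> 0" using U_bounds[OF zS] U_plus_eps_pos[OF zS] by (simp add: L_def)
  have "Dt U z - 5/2 * (G z / (U z + \<epsilon>))
      - 2 * (snd z - s) / (DIM('a) * (U z + \<epsilon>)) * (Dt U z - G z / (U z + \<epsilon>))\<^sup>2 \<le> - \<kappa> * (WC z)\<^sup>2"
    unfolding \<kappa>_def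
  proof (rule reaction_term_decay[where L = L])
    show "0 < snd z - s" "snd z - s \<le> T" using z s tT by auto
    show "0 < U z + \<epsilon>" "U z + \<epsilon> \<le> A + \<epsilon>" using U_plus_eps_pos[OF zS] U_bounds[OF zS] by auto
    show "1 \<le> real DIM('a)" by (simp add: Suc_leI)
    show "0 \<le> G z / (U z + \<epsilon>)" using U_plus_eps_pos[OF zS] by (simp add: G_def sum_nonneg)
    show "WC z = (snd z - s) * (Dt U z + G z / (U z + \<epsilon>)) - (U z + \<epsilon>) * (DIM('a) + 7/2 * L)"
      by (simp add: W_def L_def algebra_simps)
    show "G z / (U z + \<epsilon>) \<le> M" by (rule G_bound[OF z(1)])
  qed (fact L M W)+
  note decay = this
  show ?thesis
  proof (rule evolution[where s = s and C = "DIM('a) + 7/2 * ln (A + \<epsilon>)", OF z(1) pos'])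
    show "0 \<le> snd z - s" using z(2) by simp
  next
    fix w H
    assume "((\<lambda>r. WC (z + r *\<^sub>R (0, 1))) has_real_derivative w) (at 0)"
      and "\<And>i. i \<in> Basis \<Longrightarrow> \<exists>w'. (\<forall>\<^sub>F r in nhds 0.
        ((\<lambda>r. WC (z + r *\<^sub>R (i, 0))) has_real_derivative w' r) (at r)) \<and>
        (w' has_real_derivative H i) (at 0)"
      and wH: "w - (\<Sum>i\<in>Basis. H i) \<le> Dt U z - 5/2 * (G z / (U z + \<epsilon>))
        - 2 * (snd z - s) / (DIM('a) * (U z + \<epsilon>)) * (Dt U z - G z / (U z + \<epsilon>))\<^sup>2"
    then show ?thesis using that order_trans[OF wH decay] by blast
  qed
qed

text \<open>A positive maximum of \<open>\<Phi>\<close> over a compact cylinder is impossible: near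
  the sphere of radius \<open>R\<close> the barrier dominates, on the lateral boundary a step
  inwards increases \<open>\<Phi>\<close>, and inside the decay inequality fails.\<close>

lemma W_le_barrier:
  assumes x0: "x0 \<in> \<Omega>" and R: "R > 0"
  shows "WC (x0, \<tau>) \<le> (4 * DIM('a) + 25) / \<kappa> / R\<^sup>2"
proof (rule ccontr)
  define n where "n = real DIM('a)"
  \<comment> \<open>Gives \<open>\<kappa> * L = 4 * n + 25\<close>. The Laplacian of the barrier
    will bring in \<open>4 * n * d + 24 * (R\<^sup>2 - d)\<close>, and 25 instead of 24 makes the
    comparison strict.\<close>
  define L where "L = (4 * n + 25) / \<kappa>"
  define m where "m = L * R\<^sup>2"
  have L: "L > 0" using \<kappa>_pos by (simp add: L_def n_def add_nonneg_pos)
  then have m: "m > 0" using R by (simp add: m_def)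
  define B where "B x = m / (R\<^sup>2 - (norm (x - x0))\<^sup>2)\<^sup>2" for x
  define \<Phi> where "\<Phi> z = WC z - B (fst z)" for z
  assume "\<not> WC (x0, \<tau>) \<le> (4 * DIM('a) + 25) / \<kappa> / R\<^sup>2"
  moreover have "B x0 = L / R\<^sup>2" using R by (simp add: B_def m_def power2_eq_square)
  ultimately have \<Phi>0: "\<Phi> (x0, \<tau>) > 0" by (simp add: \<Phi>_def L_def n_def)
  have x0c: "x0 \<in> closure \<Omega>" using x0 closure_subset by blast
  have cpt: "compact ((closure \<Omega> \<inter> cball x0 r) \<times> {s..\<tau>})" for r
    by (intro compact_Times closed_Int_compact) auto
  have subS: "(closure \<Omega> \<inter> cball x0 r) \<times> {s..\<tau>} \<subseteq> S" for r using s by (auto simp: mem_S)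
  have Wc: "continuous_on S WC" by (rule continuous_on_W) (rule U_plus_eps_pos)
  obtain m0 where m0: "m0 > 0" "\<And>z. z \<in> (closure \<Omega> \<inter> cball x0 R) \<times> {s..\<tau>} \<Longrightarrow> WC z \<le> m0"
  proof -
    have "compact (WC ` ((closure \<Omega> \<inter> cball x0 R) \<times> {s..\<tau>}))"
      by (rule compact_continuous_image[OF continuous_on_subset[OF Wc subS] cpt])
    then obtain b where b: "\<And>y. y \<in> WC ` ((closure \<Omega> \<inter> cball x0 R) \<times> {s..\<tau>}) \<Longrightarrow> \<bar>y\<bar> \<le> b"
      by (meson bounded_real compact_imp_bounded)
    show ?thesis
    proof (rule that[of "max 1 b"])
      fix z assume "z \<in> (closure \<Omega> \<inter> cball x0 R) \<times> {s..\<tau>}"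
      then show "WC z \<le> max 1 b" using b[of "WC z"] by force
    qed simp
  qed
  \<comment> \<open>On the sphere with squared radius \<open>R\<^sup>2 - \<eta>\<close> the barrier
    equals \<open>m / \<eta>\<^sup>2\<close>, which then exceeds the bound \<open>m0\<close> of
    \<open>WC\<close>.\<close>
  obtain \<eta> where \<eta>: "0 < \<eta>" "\<eta> < R\<^sup>2" "\<eta>\<^sup>2 * m0 < m"
  proof -
    have "((\<lambda>\<eta>::real. \<eta>\<^sup>2 * m0) \<longlongrightarrow> 0) (at_right 0)" by (auto intro!: tendsto_eq_intros)
    then have "\<forall>\<^sub>F \<eta> in at_right 0. \<eta>\<^sup>2 * m0 < m" using m by (rule order_tendstoD)
    moreover have "\<forall>\<^sub>F \<eta> in at_right 0. 0 < \<eta> \<and> \<eta> < R\<^sup>2"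
      using R by (intro eventually_at_rightI[of 0 "R\<^sup>2"]) auto
    ultimately have "\<forall>\<^sub>F \<eta> in at_right 0. \<eta>\<^sup>2 * m0 < m \<and> 0 < \<eta> \<and> \<eta> < R\<^sup>2" by (rule eventually_conj)
    then show ?thesis using that eventually_happens'[of "at_right (0::real)"] by auto
  qed
  define r1 where "r1 = sqrt (R\<^sup>2 - \<eta>)"
  have r1: "r1 > 0" "r1\<^sup>2 = R\<^sup>2 - \<eta>" using \<eta> by (auto simp: r1_def)
  have r1R: "r1 < R" using r1 \<eta> R by (metis less_add_same_cancel1 diff_add_cancel power2_less_imp_less order.strict_implies_order add.commute)
  define K1 where "K1 = (closure \<Omega> \<inter> cball x0 r1) \<times> {s..\<tau>}"
  have dpos: "R\<^sup>2 - (norm (x - x0))\<^sup>2 > 0" if "x \<in> cball x0 r1" for x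
  proof -
    have "(norm (x - x0))\<^sup>2 \<le> r1\<^sup>2" using that by (intro power_mono) (auto simp: dist_norm norm_minus_commute)
    then show ?thesis using r1 \<eta> by simp
  qed
  have "continuous_on K1 \<Phi>"
    unfolding \<Phi>_def B_def
    by (intro continuous_intros continuous_on_subset[OF Wc]) (use subS dpos in \<open>force simp: K1_def\<close>)+
  moreover have x0K: "(x0, \<tau>) \<in> K1" using x0c r1 s by (simp add: K1_def)
  ultimately obtain z where z: "z \<in> K1" "\<And>y. y \<in> K1 \<Longrightarrow> \<Phi> y \<le> \<Phi> z"
    using continuous_attains_sup[OF cpt[of r1, folded K1_def]] by (metis empty_iff)
  obtain x t where xt: "z = (x, t)" by (cases z)
  have x: "x \<in> closure \<Omega>" "x \<in> cball x0 r1" and t: "s \<le> t" "t \<le> \<tau>" using z(1) by (auto simp: K1_def xt)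
  have zS: "z \<in> S" using z(1) subS by (auto simp: K1_def)
  have tT: "t \<in> {0<..<T}" using t s by auto
  have Bpos: "B x > 0" using dpos[OF x(2)] m by (simp add: B_def)
  have \<Phi>z: "\<Phi> z > 0" using z(2)[OF x0K] \<Phi>0 by simp
  then have WB: "WC z > B x" by (simp add: \<Phi>_def xt)
  have st: "s < t"
  proof (rule ccontr)
    assume "\<not> s < t"
    then have "z = (x, s)" using t xt by simp
    then show False using W_initial zS WB Bpos by (metis less_le_trans not_less order_less_imp_le)
  qed
  have xb: "x \<in> ball x0 r1"
  proof (rule ccontr)
    assume "x \<notin> ball x0 r1"
    then have "norm (x - x0) = r1" using x(2) by (simp add: dist_norm norm_minus_commute)
    then have "B x = m / \<eta>\<^sup>2" using r1 by (simp add: B_def)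
    moreover have "m / \<eta>\<^sup>2 > m0" using \<eta> by (simp add: less_divide_eq mult.commute)
    moreover have "WC z \<le> m0" using x t r1R by (intro m0(2)) (auto simp: xt)
    ultimately show False using WB by simp
  qed
  show False
  proof (cases "x \<in> \<Omega>")
    case False
    then have fr: "x \<in> frontier \<Omega>" using x(1) open_\<Omega> by (simp add: frontier_def interior_open)
    obtain N \<delta> w where N: "\<delta> > 0" "\<And>r. r \<in> {0..<\<delta>} \<Longrightarrow> x - r *\<^sub>R N \<in> closure \<Omega>"
      "(x - x0) \<bullet> N > 0" "w \<ge> 0"
      "((\<lambda>r. WC (x - r *\<^sub>R N, t)) has_real_derivative w) (at 0 within {0..<\<delta>})"
      by (rule W_boundary_increasing[where \<epsilon> = \<epsilon> and s = s and C = "DIM('a) + 7/2 * ln (A + \<epsilon>)",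
            OF fr tT t(1) U_plus_eps_pos x0]) blast+
    \<comment> \<open>Stepping inwards lowers the barrier at a strictly positive rate while the
      slope of \<open>WC\<close> is nonnegative, so \<open>\<Phi>\<close> grows.\<close>
    have "((\<lambda>r. (norm (x - r *\<^sub>R N - x0))\<^sup>2) has_real_derivative - 2 * ((x - x0) \<bullet> N)) (at 0 within {0..<\<delta>})"
      using norm_power2_line_derivative[of "x - x0" "- N" 0 "{0..<\<delta>}"] by (simp add: algebra_simps)
    from barrier_derivative[OF this, of "R\<^sup>2" m]
    have "((\<lambda>r. B (x - r *\<^sub>R N)) has_real_derivative
        2 * m * (- 2 * ((x - x0) \<bullet> N)) / (R\<^sup>2 - (norm (x - x0))\<^sup>2)^3) (at 0 within {0..<\<delta>})"
      using dpos[OF x(2)] by (simp add: B_def)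
    from DERIV_diff[OF N(5) this]
    have "((\<lambda>r. \<Phi> (x - r *\<^sub>R N, t)) has_real_derivative
        w - 2 * m * (- 2 * ((x - x0) \<bullet> N)) / (R\<^sup>2 - (norm (x - x0))\<^sup>2)^3) (at 0 within {0..<\<delta>})"
      by (simp add: \<Phi>_def)
    moreover have "2 * m * (2 * ((x - x0) \<bullet> N)) / (R\<^sup>2 - (norm (x - x0))\<^sup>2)^3 > 0"
      using m N(3) dpos[OF x(2)] by (intro divide_pos_pos mult_pos_pos zero_less_power) auto
    then have "w - 2 * m * (- 2 * ((x - x0) \<bullet> N)) / (R\<^sup>2 - (norm (x - x0))\<^sup>2)^3 > 0" using N(4) by simp
    ultimately obtain d where d: "d > 0" "\<And>h. 0 < h \<Longrightarrow> h \<in> {0..<\<delta>} \<Longrightarrow> h < d \<Longrightarrow> \<Phi> (x, t) < \<Phi> (x - h *\<^sub>R N, t)"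
      using has_real_derivative_pos_inc_right by fastforce
    have "((\<lambda>h. x - h *\<^sub>R N) \<longlongrightarrow> x) (at_right 0)" by (auto intro!: tendsto_eq_intros)
    then have 1: "\<forall>\<^sub>F h in at_right 0. x - h *\<^sub>R N \<in> ball x0 r1"
      using xb by (intro topological_tendstoD) auto
    have 2: "\<forall>\<^sub>F h in at_right (0::real). 0 < h \<and> h < min \<delta> d"
      using d N by (intro eventually_at_rightI[of 0 "min \<delta> d"]) auto
    obtain h where h: "x - h *\<^sub>R N \<in> ball x0 r1" "0 < h" "h < \<delta>" "h < d"
      using eventually_happens'[OF _ eventually_conj[OF 1 2]] by auto
    have "(x - h *\<^sub>R N, t) \<in> K1" using h t N(2)[of h] by (auto simp: K1_def less_imp_le)
    then show False using d(2)[of h] h z(2) xt by force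
  next
    case True
    have zi: "z \<in> interior S" using True tT by (simp add: interior_S_eq xt)
    have Wp: "WC z > 0" using WB Bpos by simp
    obtain w H where w: "((\<lambda>r. WC (z + r *\<^sub>R (0, 1))) has_real_derivative w) (at 0)"
      and H: "\<And>i. i \<in> Basis \<Longrightarrow> \<exists>w'. (\<forall>\<^sub>F r in nhds 0.
          ((\<lambda>r. WC (z + r *\<^sub>R (i, 0))) has_real_derivative w' r) (at r)) \<and> (w' has_real_derivative H i) (at 0)"
      and wH: "w - (\<Sum>i\<in>Basis. H i) \<le> - \<kappa> * (WC z)\<^sup>2"
      using W_decay[OF zi _ Wp] st xt by auto
    \<comment> \<open>Only earlier times are compared, since the maximum may lie at the final time;
      the barrier does not depend on time.\<close>
    have "w \<ge> 0"
    proof (rule ccontr)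
      assume "\<not> w \<ge> 0"
      then obtain d where d: "d > 0" "\<And>h. 0 < h \<Longrightarrow> h < d \<Longrightarrow> WC z < WC (z + (- h) *\<^sub>R (0, 1))"
        using DERIV_neg_dec_left[OF w] by (auto simp: zero_prod_def[symmetric])
      define h where "h = min d (t - s) / 2"
      have h: "0 < h" "h < d" "h \<le> t - s" using d(1) st by (auto simp: h_def)
      have "z + (- h) *\<^sub>R (0, 1) = (x, t - h)" by (simp add: xt)
      then have "\<Phi> z < \<Phi> (x, t - h)" using d(2)[OF h(1,2)] by (simp add: \<Phi>_def xt)
      moreover have "(x, t - h) \<in> K1" using x t h by (simp add: K1_def)
      ultimately show False using z(2) by force
    qed
    define d where "d = R\<^sup>2 - (norm (x - x0))\<^sup>2"
    have d: "d > 0" "d \<le> R\<^sup>2" using dpos[OF x(2)] by (auto simp: d_def)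
    \<comment> \<open>Second derivative of the barrier in direction \<open>i\<close>; the sum over
      \<open>Basis\<close> is its Laplacian.\<close>
    define b where "b i = 2 * m * 2 / d^3 + 6 * m * (2 * ((x - x0) \<bullet> i))\<^sup>2 / d^4" for i
    have "H i \<le> b i" if i: "i \<in> Basis" for i
    proof -
      let ?l = "\<lambda>r. x + r *\<^sub>R i"
      obtain w' where w': "\<forall>\<^sub>F r in nhds 0. ((\<lambda>r. WC (z + r *\<^sub>R (i, 0))) has_real_derivative w' r) (at r)"
        "(w' has_real_derivative H i) (at 0)" using H[OF i] by blast
      define \<sigma> where "\<sigma> r = (norm (x - x0 + r *\<^sub>R i))\<^sup>2" for r
      define \<sigma>' where "\<sigma>' r = 2 * ((x - x0 + r *\<^sub>R i) \<bullet> i)" for r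
      have \<sigma>: "(\<sigma> has_real_derivative \<sigma>' r) (at r)" for r
        unfolding \<sigma>_def[abs_def] \<sigma>'_def by (rule norm_power2_line_derivative)
      have \<sigma>': "(\<sigma>' has_real_derivative 2) (at 0)"
        unfolding \<sigma>'_def[abs_def] inner_add_left using i by (auto intro!: derivative_eq_intros)
      have \<sigma>0: "R\<^sup>2 - \<sigma> 0 = d" by (simp add: \<sigma>_def d_def)
      have Bl: "B (?l r) = m / (R\<^sup>2 - \<sigma> r)\<^sup>2" for r by (simp add: B_def \<sigma>_def algebra_simps)
      have "open (?l -` (\<Omega> \<inter> ball x0 r1))" by (intro open_vimage open_Int open_\<Omega> open_ball continuous_intros)
      then have near: "\<forall>\<^sub>F r in nhds 0. ?l r \<in> \<Omega> \<inter> ball x0 r1"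
        using True xb by (auto simp: eventually_nhds intro!: exI[of _ "?l -` (\<Omega> \<inter> ball x0 r1)"])
      have "H i - (2 * m * 2 / (R\<^sup>2 - \<sigma> 0)^3 + 6 * m * (\<sigma>' 0)\<^sup>2 / (R\<^sup>2 - \<sigma> 0)^4) \<le> 0"
      proof (rule second_derivative_le_0_at_max)
        show "\<forall>\<^sub>F r in nhds 0. ((\<lambda>r. WC (z + r *\<^sub>R (i, 0)) - B (?l r)) has_real_derivative
            w' r - 2 * m * \<sigma>' r / (R\<^sup>2 - \<sigma> r)^3) (at r)"
          using w'(1) near
        proof eventually_elim
          case (elim r)
          have "R\<^sup>2 - \<sigma> r > 0" using dpos[of "?l r"] elim(2) by (simp add: \<sigma>_def algebra_simps)
          from barrier_derivative[OF \<sigma> this, of m] elim(1)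
          show ?case unfolding Bl by (intro DERIV_diff)
        qed
        show "((\<lambda>r. w' r - 2 * m * \<sigma>' r / (R\<^sup>2 - \<sigma> r)^3) has_real_derivative
            H i - (2 * m * 2 / (R\<^sup>2 - \<sigma> 0)^3 + 6 * m * (\<sigma>' 0)\<^sup>2 / (R\<^sup>2 - \<sigma> 0)^4)) (at 0)"
          by (intro DERIV_diff w'(2) barrier_second_derivative \<sigma> \<sigma>') (use \<sigma>0 d in simp)
        show "\<forall>\<^sub>F r in nhds 0. WC (z + r *\<^sub>R (i, 0)) - B (?l r)
            \<le> WC (z + 0 *\<^sub>R (i, 0)) - B (?l 0)"
          using near
        proof eventually_elim
          case (elim r)
          have "?l r \<in> closure \<Omega>" using elim closure_subset by blast
          then have "(?l r, t) \<in> K1" using elim t by (simp add: K1_def)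
          then show ?case using z(2)[of "(?l r, t)"] by (simp add: \<Phi>_def xt)
        qed
      qed
      then show ?thesis unfolding \<sigma>0 by (simp add: b_def \<sigma>'_def)
    qed
    then have "(\<Sum>i\<in>Basis. H i) \<le> (\<Sum>i\<in>Basis. b i)" by (rule sum_mono)
    also have "\<dots> = n * (2 * m * 2 / d^3) + 6 * m * 4 / d^4 * (\<Sum>i\<in>Basis. ((x - x0) \<bullet> i)\<^sup>2)"
      by (simp add: b_def sum.distrib n_def sum_distrib_left sum_divide_distrib power_mult_distrib mult_ac)
    also have "(\<Sum>i\<in>Basis. ((x - x0) \<bullet> i)\<^sup>2) = R\<^sup>2 - d"
      unfolding d_def power2_norm_eq_inner euclidean_inner[of "x - x0" "x - x0"]
      by (simp add: power2_eq_square)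
    also have "n * (2 * m * 2 / d^3) + 6 * m * 4 / d^4 * (R\<^sup>2 - d) = m * (4 * n * d + 24 * (R\<^sup>2 - d)) / d^4"
      using d by (simp add: field_simps power3_eq_cube power4_eq_xxxx)
    also have "\<dots> < m * ((4 * n + 25) * R\<^sup>2) / d^4"
    proof (intro divide_strict_right_mono mult_strict_left_mono)
      have "4 * n * d \<le> 4 * n * R\<^sup>2" using d by (intro mult_left_mono) (auto simp: n_def)
      then show "4 * n * d + 24 * (R\<^sup>2 - d) < (4 * n + 25) * R\<^sup>2" using d by (simp add: algebra_simps)
    qed (use m d in auto)
    also have "\<dots> = \<kappa> * (B x)\<^sup>2"
    proof -
      have "(4 * n + 25) = \<kappa> * L" using \<kappa>_pos by (simp add: L_def)
      moreover have "B x = m / d\<^sup>2" by (simp only: B_def d_def)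
      then have "(B x)\<^sup>2 = m * m / d^4" by (simp add: power2_eq_square power4_eq_xxxx)
      ultimately show ?thesis by (simp add: m_def)
    qed
    \<comment> \<open>The sum of the \<open>H i\<close> is now strictly below
      \<open>\<kappa> * (WC z)\<^sup>2\<close>, so \<open>wH\<close> would make \<open>w\<close>
      negative.\<close>
    also have "\<dots> \<le> \<kappa> * (WC z)\<^sup>2"
      using WB Bpos \<kappa>_pos by (intro mult_left_mono power_mono) auto
    finally show False using wH \<open>w \<ge> 0\<close> by simp
  qed
qed

text \<open>Neither \<open>\<kappa>\<close> nor the numerator of the barrier bound depends on
  \<open>R\<close>, so the limit is 0.\<close>

lemma W_nonpos:
  assumes "x0 \<in> \<Omega>"
  shows "WC (x0, \<tau>) \<le> 0"
proof (rule tendsto_lowerbound)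
  show "((\<lambda>R. (4 * DIM('a) + 25) / \<kappa> / R\<^sup>2) \<longlongrightarrow> 0) at_top"
    by (rule real_tendsto_divide_at_top[OF tendsto_const])
      (rule filterlim_pow_at_top[OF _ filterlim_ident], simp)
  show "\<forall>\<^sub>F R in at_top. WC (x0, \<tau>) \<le> (4 * DIM('a) + 25) / \<kappa> / R\<^sup>2"
  proof (rule eventually_mono[OF eventually_gt_at_top[of 0]])
    fix R :: real assume "0 < R"
    then show "WC (x0, \<tau>) \<le> (4 * DIM('a) + 25) / \<kappa> / R\<^sup>2" by (rule W_le_barrier[OF assms])
  qed
qed simp

end

end

section \<open>The estimate\<close>

text \<open>A violation would persist on a nonempty open set, which is never negligible. It converts
  the essential bound on the gradient into a pointwise one.\<close>

lemma AE_continuous_le_imp_le: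
  fixes f :: "'a::euclidean_space \<Rightarrow> real"
  assumes Q: "open Q" and f: "continuous_on Q f" and AE: "AE z in lebesgue_on Q. f z \<le> c" and z: "z \<in> Q"
  shows "f z \<le> c"
proof (rule ccontr)
  assume "\<not> f z \<le> c"
  define V where "V = {y \<in> Q. f y > c}"
  have "open (f -` {c<..} \<inter> Q)" using continuous_on_open_vimage[OF Q] f open_greaterThan by blast
  moreover have "f -` {c<..} \<inter> Q = V" by (auto simp: V_def)
  ultimately have V: "open V" "z \<in> V" using z \<open>\<not> f z \<le> c\<close> by (auto simp: V_def)
  have "AE y in lebesgue. y \<in> Q \<longrightarrow> f y \<le> c"
    using AE Q by (subst (asm) AE_restrict_space_iff) auto
  then obtain N where N: "N \<in> null_sets lebesgue" "{y \<in> space lebesgue. \<not> (y \<in> Q \<longrightarrow> f y \<le> c)} \<subseteq> N"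
    unfolding eventually_ae_filter by blast
  then have "V \<subseteq> N" by (auto simp: V_def)
  then have "negligible V" using N(1) negligible_subset by (auto simp: negligible_iff_null_sets)
  then show False using V open_not_negligible by blast
qed

context neumann_heat
begin

text \<open>The bounds are encoded as the equation that \<open>U\<close> equals its truncation to
  [0, A], which \<open>eq_on_closure\<close> extends; strict positivity weakens to
  \<open>0 \<le> U y\<close> in the process.\<close>

lemma U_bounds_closed:
  assumes "\<And>x t. x \<in> \<Omega> \<Longrightarrow> t \<in> {0<..<T} \<Longrightarrow> 0 < u x t \<and> u x t \<le> A" and y: "y \<in> S"
  shows "0 \<le> U y \<and> U y \<le> A"
proof -
  have bd: "0 < U z \<and> U z \<le> A" if "z \<in> interior S" for z
    using that assms(1) by (auto simp: interior_S_eq U_def)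
  have c: "continuous_on S U" by (rule smooth_on_imp(1)[OF smooth_U])
  have "U y = max 0 (min A (U y))"
    by (rule eq_on_closure[OF c _ _ y]) (use bd in \<open>force intro!: continuous_intros c\<close>)+
  moreover have "A \<ge> 0"
  proof -
    obtain z where "z \<in> interior S" using interior_S by blast
    then show ?thesis using bd by fastforce
  qed
  ultimately show ?thesis by linarith
qed

lemma norm_grad_power2:
  assumes "x \<in> \<Omega>" "t \<in> {0<..<T}"
  shows "(norm (grad (\<lambda>y. u y t) x))\<^sup>2 = G (x, t)"
proof -
  define g where "g = grad (\<lambda>y. u y t) x"
  have "g \<bullet> i = D i U (x, t)" if "i \<in> Basis" for i
    using that unfolding g_def grad_slice[OF assms] by simp
  then have "g \<bullet> g = G (x, t)"
    unfolding euclidean_inner[of g g] G_def by (simp add: power2_eq_square)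
  then show ?thesis by (simp add: g_def power2_norm_eq_inner)
qed

lemma G_bounded:
  assumes "L_infinity (\<Omega> \<times> {0<..<T}) (\<lambda>(x, t). grad (\<lambda>y. u y t) x)"
  obtains K where "\<And>y. y \<in> interior S \<Longrightarrow> G y \<le> K"
proof -
  obtain K where K: "AE z in lebesgue_on (interior S). norm (case z of (x, t) \<Rightarrow> grad (\<lambda>y. u y t) x) \<le> K"
    using assms unfolding L_infinity_def interior_S_eq by blast
  have "continuous_on (interior S) G"
    unfolding G_def[abs_def]
    using smooth_on_imp(1)[OF smooth_D[OF smooth_U]] interior_subset
    by (intro continuous_intros) (blast intro: continuous_on_subset)
  moreover have "AE z in lebesgue_on (interior S). G z \<le> K\<^sup>2"
  proof (rule AE_mp[OF K], rule AE_I2, rule impI)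
    fix z assume z: "z \<in> space (lebesgue_on (interior S))"
      and le: "norm (case z of (x, t) \<Rightarrow> grad (\<lambda>y. u y t) x) \<le> K"
    obtain x t where xt: "z = (x, t)" "x \<in> \<Omega>" "t \<in> {0<..<T}"
      using z by (cases z) (auto simp: interior_S_eq)
    then have "(norm (grad (\<lambda>y. u y t) x))\<^sup>2 \<le> K\<^sup>2" using le by (intro power_mono) auto
    then show "G z \<le> K\<^sup>2" using norm_grad_power2 xt by simp
  qed
  ultimately have "\<And>y. y \<in> interior S \<Longrightarrow> G y \<le> K\<^sup>2"
    using AE_continuous_le_imp_le[OF open_interior] by blast
  then show ?thesis by (rule that)
qed

text \<open>The Laplacian of log u is that of u divided by u, minus |D log u|^2; adding twice that
  square leaves it once.\<close>

lemma log_identity: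
  assumes pos: "\<And>x t. x \<in> \<Omega> \<Longrightarrow> t \<in> {0<..<T} \<Longrightarrow> 0 < u x t" and x: "x \<in> \<Omega>" and t: "t \<in> {0<..<T}"
  shows "laplacian (\<lambda>y. ln (u y t)) x + 2 * (norm (grad (\<lambda>y. ln (u y t)) x))\<^sup>2
      = laplacian (\<lambda>y. u y t) x / u x t + (norm (grad (\<lambda>y. u y t) x))\<^sup>2 / (u x t)\<^sup>2"
proof -
  have dU: "U differentiable_on S" "\<And>b. b \<in> Basis \<Longrightarrow> D b U differentiable_on S"
    using smooth_U smooth_on_imp(2) by blast+
  have slice: "((\<lambda>y. u y t) has_derivative (\<lambda>v. D v U (y, t))) (at y)" if "y \<in> \<Omega>" for y
    using has_derivative_slice_interior[OF dU(1) that t] by (simp add: U_def)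
  have ln1: "frechet_derivative (\<lambda>y. ln (u y t)) (at y) = (\<lambda>v. D v U (y, t) / u y t)" if "y \<in> \<Omega>" for y
    by (rule sym, rule frechet_derivative_at)
      (use slice[OF that] pos[OF that t] in \<open>auto intro!: derivative_eq_intros simp: divide_inverse\<close>)
  have ln2: "frechet_derivative (\<lambda>y. frechet_derivative (\<lambda>y. ln (u y t)) (at y) b) (at x) b
      = D b (D b U) (x, t) / u x t - (D b U (x, t))\<^sup>2 / (u x t)\<^sup>2" if b: "b \<in> Basis" for b
  proof -
    have "((\<lambda>y. D b U (y, t) / u y t) has_derivative
        (\<lambda>v. (D v (D b U) (x, t) * u x t - D b U (x, t) * D v U (x, t)) / (u x t * u x t))) (at x)"
      by (rule has_derivative_divide'[OF has_derivative_slice_interior[OF dU(2)[OF b] x t] slice[OF x]])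
        (use pos[OF x t] in simp)
    then have "((\<lambda>y. frechet_derivative (\<lambda>y. ln (u y t)) (at y) b) has_derivative
        (\<lambda>v. (D v (D b U) (x, t) * u x t - D b U (x, t) * D v U (x, t)) / (u x t * u x t))) (at x)"
      by (rule has_derivative_transform_within_open[OF _ open_\<Omega> x]) (simp add: ln1)
    from frechet_derivative_at[OF this, symmetric] show ?thesis
      using pos[OF x t] by (simp add: field_simps power2_eq_square)
  qed
  have "laplacian (\<lambda>y. ln (u y t)) x
      = (\<Sum>b\<in>Basis. D b (D b U) (x, t) / u x t - (D b U (x, t))\<^sup>2 / (u x t)\<^sup>2)"
    unfolding laplacian_def by (intro sum.cong refl ln2)
  also have "\<dots> = laplacian (\<lambda>y. u y t) x / u x t - G (x, t) / (u x t)\<^sup>2"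
    unfolding laplacian_slice[OF x t] G_def by (simp add: sum_subtractf sum_divide_distrib)
  finally have "laplacian (\<lambda>y. ln (u y t)) x = laplacian (\<lambda>y. u y t) x / u x t - G (x, t) / (u x t)\<^sup>2" .
  moreover have "grad (\<lambda>y. ln (u y t)) x = grad (\<lambda>y. u y t) x /\<^sub>R u x t"
    unfolding grad_slice[OF x t] unfolding grad_def ln1[OF x]
    by (simp add: scaleR_sum_right divide_inverse mult.commute)
  then have "(norm (grad (\<lambda>y. ln (u y t)) x))\<^sup>2 = G (x, t) / (u x t)\<^sup>2"
    using norm_grad_power2[OF x t] by (simp add: power_mult_distrib power_inverse divide_inverse mult.commute)
  ultimately show ?thesis using norm_grad_power2[OF x t] by simp
qed

text \<open>\<open>s\<close> tends to 0 first, with \<open>\<epsilon>\<close> fixed. The bound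
  \<open>M\<close> blows up as \<open>\<epsilon>\<close> tends to 0, but it does not occur in the
  conclusion of \<open>W_nonpos\<close>, so the second limit is harmless.\<close>

lemma hamilton_estimate:
  assumes bounds: "\<And>x t. x \<in> \<Omega> \<Longrightarrow> t \<in> {0<..<T} \<Longrightarrow> 0 < u x t \<and> u x t \<le> A"
    and grad: "L_infinity (\<Omega> \<times> {0<..<T}) (\<lambda>(x, t). grad (\<lambda>y. u y t) x)"
    and \<tau>: "\<tau> \<in> {0<..<T}" and x: "x \<in> \<Omega>"
  shows "\<tau> * (Dt U (x, \<tau>) + G (x, \<tau>) / u x \<tau>) \<le> u x \<tau> * (DIM('a) + 7/2 * ln (A / u x \<tau>))"
proof -
  obtain K where K: "\<And>y. y \<in> interior S \<Longrightarrow> G y \<le> K" using G_bounded[OF grad] by blast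
  note Ub = U_bounds_closed[OF bounds]
  define p where "p = Dt U (x, \<tau>)"
  define g where "g = G (x, \<tau>)"
  define a where "a = u x \<tau>"
  define n where "n = real DIM('a)"
  have a: "a > 0" "a \<le> A" using bounds[OF x \<tau>] by (auto simp: a_def)
  have 1: "(\<tau> - s) * (p + g / (a + \<epsilon>)) \<le> (a + \<epsilon>) * (n + 7/2 * ln (A + \<epsilon>) - 7/2 * ln (a + \<epsilon>))"
    if s: "0 < s" "s < \<tau>" and \<epsilon>: "\<epsilon> > 0" for s \<epsilon>
  proof -
    \<comment> \<open>This is the value of \<open>M\<close>; the \<open>+ 1\<close> makes it
      positive.\<close>
    have "G y / (U y + \<epsilon>) \<le> (\<bar>K\<bar> + 1) / \<epsilon>" if y: "y \<in> interior S" for y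
    proof (rule frac_le)
      show "\<epsilon> \<le> U y + \<epsilon>" using Ub[of y] y interior_subset by auto
    qed (use K[OF y] \<epsilon> in auto)
    from W_nonpos[where A = A, OF \<epsilon> _ s(1,2) _ Ub this refl x] \<tau> \<epsilon>
    have "W s \<epsilon> (n + 7/2 * ln (A + \<epsilon>)) (x, \<tau>) \<le> 0" by (simp add: n_def)
    then show ?thesis by (simp add: W_def p_def g_def a_def U_def)
  qed
  have 2: "\<tau> * (p + g / (a + \<epsilon>)) \<le> (a + \<epsilon>) * (n + 7/2 * ln (A + \<epsilon>) - 7/2 * ln (a + \<epsilon>))"
    if \<epsilon>: "\<epsilon> > 0" for \<epsilon>
  proof (rule tendsto_upperbound)
    show "((\<lambda>s. (\<tau> - s) * (p + g / (a + \<epsilon>))) \<longlongrightarrow> \<tau> * (p + g / (a + \<epsilon>))) (at_right 0)"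
      by (auto intro!: tendsto_eq_intros)
    show "\<forall>\<^sub>F s in at_right 0. (\<tau> - s) * (p + g / (a + \<epsilon>))
        \<le> (a + \<epsilon>) * (n + 7/2 * ln (A + \<epsilon>) - 7/2 * ln (a + \<epsilon>))"
      using 1 \<epsilon> \<tau> by (intro eventually_at_rightI[of 0 \<tau>]) auto
  qed simp
  \<comment> \<open>At the fixed interior point \<open>a\<close> is positive, so both sides are
    continuous in \<open>\<epsilon>\<close> at 0.\<close>
  have "\<tau> * (p + g / a) \<le> a * (n + 7/2 * ln A - 7/2 * ln a)"
  proof (rule tendsto_le)
    show "((\<lambda>\<epsilon>. \<tau> * (p + g / (a + \<epsilon>))) \<longlongrightarrow> \<tau> * (p + g / a)) (at_right 0)"
      using a by (auto intro!: tendsto_eq_intros)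
    show "((\<lambda>\<epsilon>. (a + \<epsilon>) * (n + 7/2 * ln (A + \<epsilon>) - 7/2 * ln (a + \<epsilon>)))
        \<longlongrightarrow> a * (n + 7/2 * ln A - 7/2 * ln a)) (at_right 0)"
      using a by (auto intro!: tendsto_eq_intros)
    show "\<forall>\<^sub>F \<epsilon> in at_right 0. \<tau> * (p + g / (a + \<epsilon>))
        \<le> (a + \<epsilon>) * (n + 7/2 * ln (A + \<epsilon>) - 7/2 * ln (a + \<epsilon>))"
      using 2 by (intro eventually_at_rightI[of 0 1]) auto
  qed simp
  also have "n + 7/2 * ln A - 7/2 * ln a = n + 7/2 * ln (A / a)"
    using a by (simp add: ln_div)
  finally show ?thesis by (simp add: p_def g_def a_def n_def)
qed

end

theorem theorem3p10:
  fixes \<Omega> :: "(real ^ 'n) set"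
    and T A \<tau> :: real
    and u :: "real ^ 'n \<Rightarrow> real \<Rightarrow> real"
  assumes "open \<Omega>" and "connected \<Omega>" and "convex \<Omega>"
    and "smooth_boundary \<Omega>"
    and "interior_cone_condition \<Omega>"
    and "T > 0"
    and "neumann_heat_solution \<Omega> T u"
    and "L_infinity (\<Omega> \<times> {0<..<T}) (\<lambda>(x, t). u x t)"
    and "\<And>x t. x \<in> \<Omega> \<Longrightarrow> t \<in> {0<..<T} \<Longrightarrow> 0 < u x t \<and> u x t \<le> A"
    and "L_infinity (\<Omega> \<times> {0<..<T}) (\<lambda>(x, t). grad (\<lambda>y. u y t) x)"
    and "L2_time_W2 T 4 \<Omega> (\<lambda>t x. u x t)"
    and "\<tau> \<in> {0<..<T}"
  shows "\<forall>x\<in>\<Omega>.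
    laplacian (\<lambda>y. ln (u y \<tau>)) x + 2 * (norm (grad (\<lambda>y. ln (u y \<tau>)) x))\<^sup>2
      = laplacian (\<lambda>y. u y \<tau>) x / u x \<tau> + (norm (grad (\<lambda>y. u y \<tau>) x))\<^sup>2 / (u x \<tau>)\<^sup>2
    \<and> laplacian (\<lambda>y. u y \<tau>) x / u x \<tau> + (norm (grad (\<lambda>y. u y \<tau>) x))\<^sup>2 / (u x \<tau>)\<^sup>2
      \<le> 1 / \<tau> * (real CARD('n) + 7 / 2 * ln (A / u x \<tau>))"
proof (intro ballI conjI)
  fix x assume x: "x \<in> \<Omega>"
  \<comment> \<open>The claim is pointwise, so the chosen \<open>x\<close> supplies the nonemptiness
    of \<open>\<Omega>\<close>.\<close>
  interpret neumann_heat \<Omega> T u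
    by unfold_locales (use assms x in auto)
  show "laplacian (\<lambda>y. ln (u y \<tau>)) x + 2 * (norm (grad (\<lambda>y. ln (u y \<tau>)) x))\<^sup>2
      = laplacian (\<lambda>y. u y \<tau>) x / u x \<tau> + (norm (grad (\<lambda>y. u y \<tau>) x))\<^sup>2 / (u x \<tau>)\<^sup>2"
    using assms(9) by (intro log_identity[OF _ x assms(12)]) blast
  have pos: "u x \<tau> > 0" and \<tau>: "\<tau> > 0" using assms(9)[OF x assms(12)] assms(12) by auto
  have "(x, \<tau>) \<in> S" using x closure_subset assms(12) by (auto simp: mem_S)
  then have lap: "laplacian (\<lambda>y. u y \<tau>) x = Dt U (x, \<tau>)"
    using laplacian_slice[OF x assms(12)] heat_equation by simp
  have "\<tau> * (Dt U (x, \<tau>) + G (x, \<tau>) / u x \<tau>) \<le> u x \<tau> * (real CARD('n) + 7/2 * ln (A / u x \<tau>))"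
    using hamilton_estimate[OF assms(9) assms(10) assms(12) x] by simp
  then have "(Dt U (x, \<tau>) + G (x, \<tau>) / u x \<tau>) / u x \<tau> \<le> 1 / \<tau> * (real CARD('n) + 7/2 * ln (A / u x \<tau>))"
    using pos \<tau> by (simp add: field_simps)
  then show "laplacian (\<lambda>y. u y \<tau>) x / u x \<tau> + (norm (grad (\<lambda>y. u y \<tau>) x))\<^sup>2 / (u x \<tau>)\<^sup>2
      \<le> 1 / \<tau> * (real CARD('n) + 7 / 2 * ln (A / u x \<tau>))"
    unfolding lap norm_grad_power2[OF x assms(12)] by (simp add: add_divide_distrib power2_eq_square)
qed

end
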